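(* Assume the following. (i) The errors $\epsilon_1,\dots,\epsilon_n$ are independent with $\epsilon_i\sim\mathcal N(0,\sigma^2)$, $\sigma>0$. (ii) There is a constant $M<\infty$ with $\|x_i\|_{L_2(\Omega)}\le M$ for all $i=1,\dots,n$. (iii) The vector $\gamma^*=A\eta^*\in\mathbb R^L$ has at most $S$ nonzero components, where $S$ is an integer with $1\le S\le L$. (iv) The matrix $V=XA^+$ satisfies $\kappa_1(S)>0$. Let $$\lambda=C\sigma\sqrt{\frac{\log p}{n}}+M\mathcal E_b$$ for some constant $C>\sqrt2$, and let $\hat\eta$ be a solution of $$\min_{\eta\in\mathbb R^p}\|A\eta\|_{\ell_1}\quad\text{subject to}\quad\Big\|\frac1n N^{-1}X^\top(y-X\eta)\Big\|_{\ell_\infty}\le\lambda .$$ Put $\hat\beta(t,s)=b^\top(t,s)\hat\eta$, $\mu_i=\iint_\Omega x_i\beta\,dt\,ds$, $\hat\mu_i=\iint_\Omega x_i\hat\beta\,dt\,ds$, $\mu=(\mu_1,\dots,\mu_n)^\top$ and $\hat\mu=(\hat\mu_1,\dots,\hat\mu_n)^\top$. Then, with probability at least $1-p^{1-C^2/2}$, $$\|\hat\beta-\beta\|_{L_2(\Omega)}\le\frac{8C_b\sqrt L\,N_{\max}}{\kappa_1^2(S)\,\sigma_{\min}^2(A)}\,\lambda S+\mathcal E_b$$ and $$\|\hat\mu-\mu\|_n\le\frac{4\sqrt L\,N_{\max}}{\kappa_1(S)\,\sigma_{\min}(A)}\,\lambda\sqrt S+M\mathcal E_b ,$$ where $C_b=\big(\sum_{j=1}^p\iint_\Omega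 b_j^2(t,s)\,dt\,ds\big)^{1/2}$, $N_{\max}=\max_{1\le j\le p}N_j$, and $\sigma_{\min}(A)$ is the smallest singular value of $A$. If, in addition, $2S\le L$ and $\kappa_2(S,S)>0$, then with the same probability $$\|\hat\beta-\beta\|_{L_2(\Omega)}\le\frac{8C_b\sqrt L\,N_{\max}}{\kappa_2^2(S,S)\,\sigma_{\min}^2(A)}\,\lambda\sqrt S+\mathcal E_b .$$
   Context: Setting. $\Omega=[0,1]\times[0,1]$; $\|f\|_{L_2(\Omega)}=(\iint_\Omega f^2\,dt\,ds)^{1/2}$. The (centered) scalar-on-image linear model is $$y_i=\iint_\Omega x_i(t,s)\beta(t,s)\,dt\,ds+\epsilon_i,\qquad i=1,\dots,n,$$ with fixed $x_i\in L_2(\Omega)$, unknown coefficient function $\beta\in L_2(\Omega)$, and random errors $\epsilon_i$; $y=(y_1,\dots,y_n)^\top$. Standing assumptions on $\beta$: it vanishes on some subset of $\Omega$ of positive measure, and for some $r_1,r_2\in\mathbb N$ all partial derivatives $\partial_t^{\alpha_1}\partial_s^{\alpha_2}\beta$ with $0\le\alpha_1\le r_1$, $0\le\alpha_2\le r_2$ lie in $L_2(\Omega)$. Basis. $b_1,\dots,b_p\in L_2(\Omega)$ are given (linearly independent) basis functions, $b=(b_1,\dots,b_p)^\top$. $\eta^*\in\mathbb R^p$ is the minimizer of $\|\beta-b^\top\eta\|_{L_2(\Omega)}$ over $\eta\in\mathbb R^p$, $\beta^*=b^\top\eta^*$, and $\mathcal E_b=\|\beta-\beta^*\|_{L_2(\Omega)}$.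 $X\in\mathbb R^{n\times p}$ has entries $X_{ij}=\iint_\Omega x_i b_j\,dt\,ds$. For $u\in\mathbb R^n$, $\|u\|_n^2=\frac1n\sum_{i=1}^n u_i^2$. $N=\mathrm{diag}(N_1,\dots,N_p)$ with $N_j=\|X_{\cdot j}\|_n$ ($X_{\cdot j}$ the $j$th column of $X$), all $N_j>0$. Matrix $A$. $\{(t_k,s_l):1\le k\le m_1,1\le l\le m_2\}\subset\Omega$ is an evenly spaced grid with grid lengths $\delta_1,\delta_2>0$ in the $t$ and $s$ directions. $\Phi^\top\in\mathbb R^{m_1m_2\times p}$ is the matrix whose row with index $(k-1)m_2+l$ is $(b_1(t_k,s_l),\dots,b_p(t_k,s_l))$. For integers $0\le d<m$, $D_m^d$ is the $(m-d)\times m$ matrix with entries $D_m^d(i,i+k)=(-1)^k\binom dk$ for $k=0,\dots,d$ and $0$ otherwise ($D_m^0=I_m$). For orders $d_1<m_1$, $d_2<m_2$, $A^{d_1,0}=\delta_1^{-d_1}D_{m_1}^{d_1}\otimes I_{m_2}$, $A^{0,d_2}=\delta_2^{-d_2}I_{m_1}\otimes D_{m_2}^{d_2}$, and, for a weight $w>0$, $$A=\begin{bmatrix} wI_{m_1m_2} \\ A^{d_1,0} \\ A^{0,d_2} \end{bmatrix}\Phi^\top\in\mathbb R^{L\times p},\quad L=m_1m_2+(m_1-d_1)m_2+m_1(m_2-d_2).$$ $A$ is assumed to have full column rank ($L\ge p$); $A^+\in\mathbb R^{p\times L}$ is its Moore–Penrose pseudoinverse (so $A^+A=I_p$), and $V=XA^+\in\mathbb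 R^{n\times L}$. Restricted eigenvalues. For $h\in\mathbb R^L$ and $\mathcal T\subseteq\{1,\dots,L\}$, $h_{\mathcal T}$ denotes $h$ with entries outside $\mathcal T$ set to zero. For $1\le S\le L$, $$\kappa_1(S)=\min_{\mathcal T_0\subset\{1,\dots,L\},\,|\mathcal T_0|\le S}\ \min_{h\ne0,\ \|h_{\mathcal T_0^\complement}\|_{\ell_1}\le\|h_{\mathcal T_0}\|_{\ell_1}}\frac{\|Vh\|_{\ell_2}}{\sqrt n\,\|h_{\mathcal T_0}\|_{\ell_2}} .$$ For $1\le S\le S'\le L$ with $S+S'\le L$, $$\kappa_2(S,S')=\min_{\mathcal T_0\subset\{1,\dots,L\},\,|\mathcal T_0|\le S}\ \min_{h\ne0,\ \|h_{\mathcal T_0^\complement}\|_{\ell_1}\le\|h_{\mathcal T_0}\|_{\ell_1}}\frac{\|Vh\|_{\ell_2}}{\sqrt n\,\|h_{\mathcal T_{01}}\|_{\ell_2}} ,$$ where $\mathcal T_1$ is the index set of the $S'$ largest (in magnitude) entries of $h$ outside $\mathcal T_0$ and $\mathcal T_{01}=\mathcal T_0\cup\mathcal T_1$. *)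

theory Defs
  imports
    "HOL-Probability.Probability"
    "Jordan_Normal_Form.Char_Poly"
    "Jordan_Normal_Form.DL_Rank"
begin

(* Matrices and vectors are the ones of Jordan_Normal_Form (with 0-based indices), since the
   dimensions are related arithmetically; the types and notation of Finite_Cartesian_Product
   are hidden. *)
unbundle no vec_syntax
hide_type (open) Finite_Cartesian_Product.vec
hide_const (open) Finite_Cartesian_Product.vec Finite_Cartesian_Product.mat
  Finite_Cartesian_Product.row Finite_Cartesian_Product.transpose Determinants.det
  Cartesian_Space.rank

section \<open>Square integrable functions on the unit square\<close>

abbreviation unit_square :: "(real \<times> real) set"  (\<open>\<Omega>\<close>) where
  "\<Omega> \<equiv> {0..1} \<times> {0..1}"

definition L2_fun :: "(real \<times> real \<Rightarrow> real) \<Rightarrow> bool" where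
  "L2_fun f \<longleftrightarrow> f \<in> borel_measurable (lebesgue_on \<Omega>) \<and> integrable (lebesgue_on \<Omega>) (\<lambda>z. (f z)\<^sup>2)"

definition L2_inner :: "(real \<times> real \<Rightarrow> real) \<Rightarrow> (real \<times> real \<Rightarrow> real) \<Rightarrow> real" where
  "L2_inner f g = (LINT z|lebesgue_on \<Omega>. f z * g z)"

definition L2_norm :: "(real \<times> real \<Rightarrow> real) \<Rightarrow> real" where
  "L2_norm f = sqrt (LINT z|lebesgue_on \<Omega>. (f z)\<^sup>2)"

(* Linear independence in L_2, i.e. modulo equality almost everywhere. *)
definition L2_independent :: "nat \<Rightarrow> (nat \<Rightarrow> real \<times> real \<Rightarrow> real) \<Rightarrow> bool" where
  "L2_independent p b \<longleftrightarrow>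
     (\<forall>c :: nat \<Rightarrow> real.
        (AE z in lebesgue_on \<Omega>. (\<Sum>j<p. c j * b j z) = 0) \<longrightarrow> (\<forall>j<p. c j = 0))"

definition basis_comb :: "(nat \<Rightarrow> real \<times> real \<Rightarrow> real) \<Rightarrow> real vec \<Rightarrow> real \<times> real \<Rightarrow> real" where
  "basis_comb b \<eta> z = (\<Sum>j<dim_vec \<eta>. b j z * \<eta> $ j)"

subsection \<open>Weak partial derivatives\<close>

definition partial_t :: "(real \<times> real \<Rightarrow> real) \<Rightarrow> real \<times> real \<Rightarrow> real" where
  "partial_t \<phi> = (\<lambda>(t, s). deriv (\<lambda>u. \<phi> (u, s)) t)"

definition partial_s :: "(real \<times> real \<Rightarrow> real) \<Rightarrow> real \<times> real \<Rightarrow> real" where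
  "partial_s \<phi> = (\<lambda>(t, s). deriv (\<lambda>u. \<phi> (t, u)) s)"

fun C_k :: "nat \<Rightarrow> (real \<times> real \<Rightarrow> real) \<Rightarrow> bool" where
  "C_k 0 \<phi> \<longleftrightarrow> continuous_on UNIV \<phi>"
| "C_k (Suc k) \<phi> \<longleftrightarrow> continuous_on UNIV \<phi> \<and>
     (\<forall>t s. (\<lambda>u. \<phi> (u, s)) differentiable (at t) \<and> (\<lambda>u. \<phi> (t, u)) differentiable (at s)) \<and>
     C_k k (partial_t \<phi>) \<and> C_k k (partial_s \<phi>)"

definition test_function :: "(real \<times> real \<Rightarrow> real) \<Rightarrow> bool" where
  "test_function \<phi> \<longleftrightarrow> (\<forall>k. C_k k \<phi>) \<and>
     (\<exists>K. compact K \<and> K \<subseteq> interior \<Omega> \<and> (\<forall>z. z \<notin> K \<longrightarrow> \<phi> z = 0))"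

(* g is the weak derivative of f of order a1 in the first and a2 in the second variable. *)
definition weak_partial ::
  "nat \<Rightarrow> nat \<Rightarrow> (real \<times> real \<Rightarrow> real) \<Rightarrow> (real \<times> real \<Rightarrow> real) \<Rightarrow> bool" where
  "weak_partial a1 a2 f g \<longleftrightarrow>
     (\<forall>\<phi>. test_function \<phi> \<longrightarrow>
        L2_inner f ((partial_t ^^ a1) ((partial_s ^^ a2) \<phi>)) = (-1) ^ (a1 + a2) * L2_inner g \<phi>)"

definition L2_partials :: "nat \<Rightarrow> nat \<Rightarrow> (real \<times> real \<Rightarrow> real) \<Rightarrow> bool" where
  "L2_partials r1 r2 f \<longleftrightarrow> (\<forall>a1\<le>r1. \<forall>a2\<le>r2. \<exists>g. L2_fun g \<and> weak_partial a1 a2 f g)"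

definition vanishes_on_positive_measure :: "(real \<times> real \<Rightarrow> real) \<Rightarrow> bool" where
  "vanishes_on_positive_measure f \<longleftrightarrow>
     (\<exists>Z \<in> sets lebesgue. Z \<subseteq> \<Omega> \<and> emeasure lebesgue Z > 0 \<and> (\<forall>z\<in>Z. f z = 0))"

section \<open>Vectors and matrices\<close>

definition vec_l1 :: "real vec \<Rightarrow> real" where
  "vec_l1 v = (\<Sum>i<dim_vec v. \<bar>v $ i\<bar>)"

definition vec_l2 :: "real vec \<Rightarrow> real" where
  "vec_l2 v = sqrt (\<Sum>i<dim_vec v. (v $ i)\<^sup>2)"

definition vec_linf :: "real vec \<Rightarrow> real" where
  "vec_linf v = Max ((\<lambda>i. \<bar>v $ i\<bar>) ` {..<dim_vec v})"

definition emp_norm :: "real vec \<Rightarrow> real" where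
  "emp_norm u = sqrt (1 / real (dim_vec u) * (\<Sum>i<dim_vec u. (u $ i)\<^sup>2))"

definition restrict_vec :: "real vec \<Rightarrow> nat set \<Rightarrow> real vec" where
  "restrict_vec h T = vec (dim_vec h) (\<lambda>i. if i \<in> T then h $ i else 0)"

definition kronecker :: "real mat \<Rightarrow> real mat \<Rightarrow> real mat" where
  "kronecker A B = mat (dim_row A * dim_row B) (dim_col A * dim_col B)
     (\<lambda>(i, j). A $$ (i div dim_row B, j div dim_col B) * B $$ (i mod dim_row B, j mod dim_col B))"

definition is_pseudoinverse :: "real mat \<Rightarrow> real mat \<Rightarrow> bool" where
  "is_pseudoinverse A P \<longleftrightarrow> P \<in> carrier_mat (dim_col A) (dim_row A) \<and>
     A * P * A = A \<and> P * A * P = P \<and>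
     transpose_mat (A * P) = A * P \<and> transpose_mat (P * A) = P * A"

definition pseudoinverse :: "real mat \<Rightarrow> real mat" where
  "pseudoinverse A = (THE P. is_pseudoinverse A P)"

(* For a matrix with at least as many rows as columns. *)
definition sigma_min :: "real mat \<Rightarrow> real" where
  "sigma_min A = Min {sqrt e |e. eigenvalue (transpose_mat A * A) e}"

section \<open>Design matrix and penalty matrix\<close>

definition design_mat ::
  "nat \<Rightarrow> nat \<Rightarrow> (nat \<Rightarrow> real \<times> real \<Rightarrow> real) \<Rightarrow> (nat \<Rightarrow> real \<times> real \<Rightarrow> real) \<Rightarrow> real mat" where
  "design_mat n p x b = mat n p (\<lambda>(i, j). L2_inner (x i) (b j))"

definition diff_mat :: "nat \<Rightarrow> nat \<Rightarrow> real mat" where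
  "diff_mat m d = mat (m - d) m
     (\<lambda>(i, j). if i \<le> j \<and> j \<le> i + d then (-1) ^ (j - i) * real (d choose (j - i)) else 0)"

(* The transpose of Phi; row k * m2 + l belongs to the grid point (t k, s l). *)
definition grid_mat ::
  "nat \<Rightarrow> nat \<Rightarrow> nat \<Rightarrow> (nat \<Rightarrow> real) \<Rightarrow> (nat \<Rightarrow> real) \<Rightarrow> (nat \<Rightarrow> real \<times> real \<Rightarrow> real) \<Rightarrow> real mat" where
  "grid_mat m1 m2 p t s b = mat (m1 * m2) p (\<lambda>(i, j). b j (t (i div m2), s (i mod m2)))"

definition penalty_mat ::
  "nat \<Rightarrow> nat \<Rightarrow> nat \<Rightarrow> nat \<Rightarrow> real \<Rightarrow> real \<Rightarrow> real \<Rightarrow> nat \<Rightarrow>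
   (nat \<Rightarrow> real) \<Rightarrow> (nat \<Rightarrow> real) \<Rightarrow> (nat \<Rightarrow> real \<times> real \<Rightarrow> real) \<Rightarrow> real mat" where
  "penalty_mat m1 m2 d1 d2 \<delta>1 \<delta>2 w p t s b =
     ((w \<cdot>\<^sub>m 1\<^sub>m (m1 * m2)) @\<^sub>r
      (((1 / \<delta>1 ^ d1) \<cdot>\<^sub>m kronecker (diff_mat m1 d1) (1\<^sub>m m2)) @\<^sub>r
       ((1 / \<delta>2 ^ d2) \<cdot>\<^sub>m kronecker (1\<^sub>m m1) (diff_mat m2 d2))))
     * grid_mat m1 m2 p t s b"

section \<open>Restricted eigenvalues\<close>

definition in_cone :: "real vec \<Rightarrow> nat set \<Rightarrow> bool" where
  "in_cone h T0 \<longleftrightarrow> h \<noteq> 0\<^sub>v (dim_vec h) \<and>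
     vec_l1 (restrict_vec h (- T0)) \<le> vec_l1 (restrict_vec h T0)"

(* T1 consists of the indices of the m largest (in magnitude) entries of h outside T0.  When
   there are ties T1 is not unique, but the l_2 norm of h restricted to T0 and T1 is. *)
definition largest_outside :: "real vec \<Rightarrow> nat set \<Rightarrow> nat \<Rightarrow> nat set \<Rightarrow> bool" where
  "largest_outside h T0 m T1 \<longleftrightarrow> T1 \<subseteq> {..<dim_vec h} - T0 \<and> card T1 = m \<and>
     (\<forall>i\<in>T1. \<forall>j \<in> {..<dim_vec h} - (T0 \<union> T1). \<bar>h $ j\<bar> \<le> \<bar>h $ i\<bar>)"

(* The infima below are minima: the quotients are continuous and invariant under scaling of h,
   and the denominators do not vanish on the cone. *)
definition kappa1 :: "real mat \<Rightarrow> nat \<Rightarrow> real" where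
  "kappa1 V S = Inf {vec_l2 (V *\<^sub>v h) / (sqrt (real (dim_row V)) * vec_l2 (restrict_vec h T0)) |T0 h.
     T0 \<subseteq> {..<dim_col V} \<and> card T0 \<le> S \<and> h \<in> carrier_vec (dim_col V) \<and> in_cone h T0}"

definition kappa2 :: "real mat \<Rightarrow> nat \<Rightarrow> nat \<Rightarrow> real" where
  "kappa2 V S S' = Inf {vec_l2 (V *\<^sub>v h) / (sqrt (real (dim_row V)) * vec_l2 (restrict_vec h (T0 \<union> T1))) |T0 T1 h.
     T0 \<subseteq> {..<dim_col V} \<and> card T0 \<le> S \<and> h \<in> carrier_vec (dim_col V) \<and> in_cone h T0 \<and>
     largest_outside h T0 S' T1}"

section \<open>Probability\<close>

(* Q need not define a measurable set (it may involve a non-measurable selection of a minimizer);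
   if it does, this is just q \<le> prob {\<omega> \<in> space P. Q \<omega>}. *)
definition with_prob_at_least :: "'w measure \<Rightarrow> real \<Rightarrow> ('w \<Rightarrow> bool) \<Rightarrow> bool" where
  "with_prob_at_least P q Q \<longleftrightarrow> (\<exists>E \<in> sets P. q \<le> measure P E \<and> (\<forall>\<omega>\<in>E. Q \<omega>))"

end

theory Submission
  imports Defs
begin

text \<open>Split the residual of \<open>\<eta>\<^sup>*\<close> into noise and the bias from \<open>\<beta> - \<beta>\<^sup>*\<close>. The
  normalised correlations of the noise with the columns of \<open>X\<close> are Gaussian with variance
  \<open>\<sigma>\<^sup>2 / n\<close>, and those of the bias are at most \<open>M \<E>\<^sub>b\<close> by Cauchy--Schwarz, so a union bound
  makes \<open>\<eta>\<^sup>*\<close> feasible with the stated probability. On that event put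
  \<open>d = \<eta>_hat - \<eta>\<^sup>*\<close> and \<open>h = A d\<close>. Minimality of \<open>\<eta>_hat\<close> and sparsity of \<open>A \<eta>\<^sup>*\<close> place \<open>h\<close> in
  the cone, and \<open>V h = X d\<close> because \<open>A\<^sup>+\<close> is a left inverse of \<open>A\<close>. Feasibility of both vectors
  bounds \<open>\<parallel>X d\<parallel>\<^sup>2 / n\<close> by \<open>2 \<lambda> N_max \<parallel>d\<parallel>\<^sub>1\<close>, while \<open>\<parallel>d\<parallel>\<^sub>1 \<le> sqrt L \<parallel>d\<parallel>\<^sub>2\<close>,
  \<open>\<sigma>_min \<parallel>d\<parallel>\<^sub>2 \<le> \<parallel>h\<parallel>\<^sub>2\<close> and the restricted eigenvalue bounds \<open>\<parallel>h\<parallel>\<^sub>2\<close> by a multiple of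
  \<open>\<parallel>X d\<parallel>\<close>; solving the resulting quadratic inequality gives all three bounds. For \<open>\<kappa>\<^sub>2\<close> the
  argument gives a bound without the factor \<open>sqrt S\<close>.\<close>

unbundle no inner_syntax

section \<open>Least singular value and pseudoinverse\<close>

lemma (in vec_space) exists_maximal_indep_cols:
  obtains T where "maximal T (\<lambda>T. T \<subseteq> set (cols A) \<and> lin_indpt T)"
  using maximal_exists[of "(\<lambda>T. T \<subseteq> set (cols A) \<and> lin_indpt T)" "card (set (cols A))" "{}"]
  by (meson List.finite_set card_mono empty_iff empty_subsetI finite_lin_indpt2 rev_finite_subset)

text \<open>Linear independence concerns the set of columns, so repeated columns have to be excluded
  first: the rank is the size of an independent subset of that set, which forces the
  \<open>nc\<close> columns to be distinct. A nonzero kernel vector would then be a linear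
  dependence.\<close>

lemma full_rank_imp_injective:
  fixes A :: "real mat"
  assumes A: "A \<in> carrier_mat n nc" and rank: "vec_space.rank n A = nc"
    and v: "v \<in> carrier_vec nc" and Av: "A *\<^sub>v v = 0\<^sub>v n"
  shows "v = 0\<^sub>v nc"
proof -
  interpret vec_space "TYPE(real)" n .
  obtain T where T: "maximal T (\<lambda>T. T \<subseteq> set (cols A) \<and> lin_indpt T)"
    by (rule exists_maximal_indep_cols)
  have "card T \<le> card (set (cols A))"
    using T by (simp add: card_mono maximal_def)
  then have "length (cols A) \<le> card (set (cols A))"
    using rank_card_indpt[OF A T] rank A by simp
  then have "distinct (cols A)"
    by (metis card_distinct card_length le_antisym)
  then show ?thesis
    using full_rank_lin_indpt[OF A rank] lin_depI[OF A v _ Av] by blast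
qed

text \<open>Independent columns number at most the dimension. This later provides
  \<open>p \<le> L\<close>, which brings \<open>sqrt L\<close> into the final bounds.\<close>

lemma rank_le_nr:
  fixes A :: "real mat"
  assumes A: "A \<in> carrier_mat n nc"
  shows "vec_space.rank n A \<le> n"
proof -
  interpret vec_space "TYPE(real)" n .
  obtain T where T: "maximal T (\<lambda>T. T \<subseteq> set (cols A) \<and> lin_indpt T)"
    by (rule exists_maximal_indep_cols)
  then have "T \<subseteq> carrier_vec n" "lin_indpt T"
    using cols_dim[of A] A by (auto simp: maximal_def)
  then have "card T \<le> dim"
    using li_le_dim(2)[OF fin_dim] by simp
  then show ?thesis
    using rank_card_indpt[OF A T] dim_is_n by simp
qed

section \<open>Euclidean norm and scalar product\<close>

lemma vec_l2_nonneg [simp]: "0 \<le> vec_l2 v"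
  by (simp add: vec_l2_def sum_nonneg)

lemma vec_l1_nonneg [simp]: "0 \<le> vec_l1 v"
  by (simp add: vec_l1_def sum_nonneg)

lemma vec_l2_power2: "(vec_l2 v)\<^sup>2 = v \<bullet> v"
  by (simp add: vec_l2_def sum_nonneg scalar_prod_def power2_eq_square atLeast0LessThan)

lemma scalar_prod_self_nonneg: "0 \<le> v \<bullet> (v :: real vec)"
  by (metis vec_l2_power2 zero_le_power2)

lemma scalar_prod_self_eq_0_iff:
  "(v :: real vec) \<in> carrier_vec n \<Longrightarrow> v \<bullet> v = 0 \<longleftrightarrow> v = 0\<^sub>v n"
  using conjugate_square_eq_0_vec[of v n] by (simp add: conjugate_vec_def scalar_prod_def)

lemma scalar_prod_Cauchy_Schwarz:
  fixes u v :: "real vec"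
  assumes "u \<in> carrier_vec n" "v \<in> carrier_vec n"
  shows "(u \<bullet> v)\<^sup>2 \<le> (u \<bullet> u) * (v \<bullet> v)"
  using Cauchy_Schwarz_ineq_sum[of "\<lambda>i. u $ i" "\<lambda>i. v $ i" "{0..<n}"] assms
  by (simp add: scalar_prod_def power2_eq_square)

lemma abs_scalar_prod_le:
  assumes "u \<in> carrier_vec n" "v \<in> carrier_vec n"
  shows "\<bar>u \<bullet> v\<bar> \<le> vec_l2 u * vec_l2 v"
  using scalar_prod_Cauchy_Schwarz[OF assms]
  by (intro abs_le_square_iff[THEN iffD2, of "u \<bullet> v" "vec_l2 u * vec_l2 v", simplified abs_mult abs_of_nonneg[OF vec_l2_nonneg]])
     (simp add: power_mult_distrib vec_l2_power2)

text \<open>Cauchy-Schwarz on each row gives the squared Frobenius norm as a constant; the added 1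
  keeps it positive for the zero matrix.\<close>

lemma mult_mat_vec_bounded:
  fixes M :: "real mat"
  assumes M: "M \<in> carrier_mat m n"
  obtains K where "K > 0" "\<And>v. v \<in> carrier_vec n \<Longrightarrow> (M *\<^sub>v v) \<bullet> (M *\<^sub>v v) \<le> K * (v \<bullet> v)"
proof
  let ?K = "1 + (\<Sum>i<m. row M i \<bullet> row M i)"
  show "?K > 0"
    by (intro add_pos_nonneg sum_nonneg scalar_prod_self_nonneg) simp
  fix v :: "real vec" assume v: "v \<in> carrier_vec n"
  have "(M *\<^sub>v v) \<bullet> (M *\<^sub>v v) = (\<Sum>i<m. (row M i \<bullet> v)\<^sup>2)"
    using M by (simp add: scalar_prod_def[of "M *\<^sub>v v"] power2_eq_square atLeast0LessThan)
  also have "\<dots> \<le> (\<Sum>i<m. (row M i \<bullet> row M i) * (v \<bullet> v))"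
    using M v by (intro sum_mono scalar_prod_Cauchy_Schwarz) auto
  also have "\<dots> \<le> ?K * (v \<bullet> v)"
    by (simp add: sum_distrib_right distrib_right scalar_prod_self_nonneg)
  finally show "(M *\<^sub>v v) \<bullet> (M *\<^sub>v v) \<le> ?K * (v \<bullet> v)" .
qed

section \<open>Symmetric positive semidefinite matrices and their least eigenvalue\<close>

lemma symmetric_mat_scalar_prod:
  fixes M :: "real mat"
  assumes "M \<in> carrier_mat n n" "transpose_mat M = M" "u \<in> carrier_vec n" "v \<in> carrier_vec n"
  shows "(M *\<^sub>v u) \<bullet> v = u \<bullet> (M *\<^sub>v v)"
  using transpose_vec_mult_scalar[of M n n v u] assms by simp

text \<open>This is the Cauchy--Schwarz inequality of the semi-inner product \<open>u \<bullet> (M *\<^sub>v v)\<close>, applied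
  to \<open>v\<close> and \<open>M *\<^sub>v v\<close>.\<close>

lemma psd_image_bound:
  fixes M :: "real mat"
  assumes M: "M \<in> carrier_mat n n" and sym: "transpose_mat M = M"
    and psd: "\<And>v. v \<in> carrier_vec n \<Longrightarrow> 0 \<le> v \<bullet> (M *\<^sub>v v)"
  obtains K where "K > 0"
    "\<And>v. v \<in> carrier_vec n \<Longrightarrow> (M *\<^sub>v v) \<bullet> (M *\<^sub>v v) \<le> K * (v \<bullet> (M *\<^sub>v v))"
proof -
  obtain K where K: "K > 0"
    "\<And>v. v \<in> carrier_vec n \<Longrightarrow> (M *\<^sub>v v) \<bullet> (M *\<^sub>v v) \<le> K * (v \<bullet> v)"
    using mult_mat_vec_bounded[OF M] by blast
  have "(M *\<^sub>v v) \<bullet> (M *\<^sub>v v) \<le> (K + 1) * (v \<bullet> (M *\<^sub>v v))" if v: "v \<in> carrier_vec n" for v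
  proof -
    define u where "u = M *\<^sub>v v"
    define q where "q = u \<bullet> u"
    define r where "r = v \<bullet> (M *\<^sub>v v)"
    define z where "z = u \<bullet> (M *\<^sub>v u)"
    have u: "u \<in> carrier_vec n" using M v by (simp add: u_def)
    have Mu: "M *\<^sub>v u \<in> carrier_vec n" using M u by simp
    have q0: "q \<ge> 0" by (simp add: q_def scalar_prod_self_nonneg)
    have z: "z \<le> (K + 1) * q"
    proof -
      have "z\<^sup>2 \<le> q * ((M *\<^sub>v u) \<bullet> (M *\<^sub>v u))"
        unfolding z_def q_def by (rule scalar_prod_Cauchy_Schwarz[OF u Mu])
      also have "\<dots> \<le> q * (K * q)"
        using K(2)[OF u] q0 by (intro mult_left_mono) (auto simp: q_def)
      also have "\<dots> = K * q\<^sup>2"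
        by (simp add: power2_eq_square)
      \<comment> \<open>Enlarging \<open>K\<close> to the square of \<open>K + 1\<close> lets the
        root be taken without introducing \<open>sqrt K\<close>.\<close>
      also have "\<dots> \<le> (K + 1)\<^sup>2 * q\<^sup>2"
        using K(1) by (intro mult_right_mono) (auto simp: power2_eq_square distrib_left)
      also have "\<dots> = ((K + 1) * q)\<^sup>2"
        by (rule power_mult_distrib[symmetric])
      finally have "z\<^sup>2 \<le> ((K + 1) * q)\<^sup>2" .
      then show ?thesis
        by (rule power2_le_imp_le) (use q0 K(1) in simp)
    qed
    have quad: "0 \<le> (v - a \<cdot>\<^sub>v u) \<bullet> (M *\<^sub>v (v - a \<cdot>\<^sub>v u))" for a
      by (rule psd) (use u v in simp)
    have quad_eq: "(v - a \<cdot>\<^sub>v u) \<bullet> (M *\<^sub>v (v - a \<cdot>\<^sub>v u)) = r - 2 * a * q + a\<^sup>2 * z" for a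
    proof -
      have au: "a \<cdot>\<^sub>v u \<in> carrier_vec n" and aMu: "a \<cdot>\<^sub>v (M *\<^sub>v u) \<in> carrier_vec n"
        using u Mu by simp_all
      have "M *\<^sub>v (v - a \<cdot>\<^sub>v u) = u - a \<cdot>\<^sub>v (M *\<^sub>v u)"
        unfolding mult_minus_distrib_mat_vec[OF M v au] mult_mat_vec[OF M u]
        by (simp add: u_def)
      then have "(v - a \<cdot>\<^sub>v u) \<bullet> (M *\<^sub>v (v - a \<cdot>\<^sub>v u)) = (v - a \<cdot>\<^sub>v u) \<bullet> (u - a \<cdot>\<^sub>v (M *\<^sub>v u))"
        by simp
      also have "\<dots> = (v \<bullet> u - v \<bullet> (a \<cdot>\<^sub>v (M *\<^sub>v u))) - ((a \<cdot>\<^sub>v u) \<bullet> u - (a \<cdot>\<^sub>v u) \<bullet> (a \<cdot>\<^sub>v (M *\<^sub>v u)))"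
        unfolding minus_scalar_prod_distrib[OF v au minus_carrier_vec[OF u aMu]]
          scalar_prod_minus_distrib[OF v u aMu] scalar_prod_minus_distrib[OF au u aMu] ..
      also have "\<dots> = (v \<bullet> u - a * (v \<bullet> (M *\<^sub>v u))) - (a * q - a * (a * z))"
        using u v Mu by (simp add: q_def z_def)
      also have "\<dots> = (r - a * q) - (a * q - a * (a * z))"
        using symmetric_mat_scalar_prod[OF M sym v u] unfolding r_def q_def u_def by simp
      also have "\<dots> = r - 2 * a * q + a\<^sup>2 * z" by (simp add: power2_eq_square)
      finally show ?thesis .
    qed
    \<comment> \<open>After \<open>z\<close> is replaced by its bound \<open>(K + 1) * q\<close>,
      the quadratic in \<open>a\<close> is least at \<open>a = 1 / (K + 1)\<close>.\<close>
    have "0 \<le> r - 2 * q / (K + 1) + z / (K + 1)\<^sup>2"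
      using quad[of "1 / (K + 1)"] unfolding quad_eq by (simp add: power_divide)
    moreover have "z / (K + 1)\<^sup>2 \<le> (K + 1) * q / (K + 1)\<^sup>2"
      using z by (intro divide_right_mono) auto
    moreover have "(K + 1) * q / (K + 1)\<^sup>2 = q / (K + 1)"
      using K(1) by (simp add: power2_eq_square)
    ultimately have "q / (K + 1) \<le> r" by simp
    then have "q \<le> (K + 1) * r"
      using K(1) by (simp add: pos_divide_le_eq mult.commute)
    then show ?thesis
      unfolding q_def r_def u_def .
  qed
  then show ?thesis using K(1) by (intro that[of "K + 1"]) auto
qed

text \<open>The infimum \<open>c\<close> of the Rayleigh quotient is an eigenvalue: if \<open>M - c I\<close> were invertible,
  then its quadratic form, which is positive semidefinite, would be bounded below by a positive
  multiple of the squared norm, contradicting the choice of \<open>c\<close>.\<close>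

lemma symmetric_mat_least_eigenvalue:
  fixes M :: "real mat"
  assumes M: "M \<in> carrier_mat n n" and sym: "transpose_mat M = M" and n: "n > 0"
    and psd: "\<And>v. v \<in> carrier_vec n \<Longrightarrow> 0 \<le> v \<bullet> (M *\<^sub>v v)"
  obtains c where "eigenvalue M c" "\<And>v. v \<in> carrier_vec n \<Longrightarrow> c * (v \<bullet> v) \<le> v \<bullet> (M *\<^sub>v v)"
proof -
  define R where "R = {(v \<bullet> (M *\<^sub>v v)) / (v \<bullet> v) |v. v \<in> carrier_vec n \<and> v \<noteq> 0\<^sub>v n}"
  define c where "c = Inf R"
  define B where "B = M - c \<cdot>\<^sub>m 1\<^sub>m n"
  \<comment> \<open>The hypothesis \<open>n > 0\<close> supplies a nonzero vector, so the infimum is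
    taken over a nonempty set.\<close>
  have "unit_vec n 0 \<noteq> (0\<^sub>v n :: real vec)"
    using n by (metis index_unit_vec(2) index_zero_vec(1) zero_neq_one)
  then have R_ne: "R \<noteq> {}" by (auto simp: R_def intro!: exI[of _ "unit_vec n 0"])
  have bdd: "bdd_below R"
    using psd by (intro bdd_belowI[of _ 0]) (auto simp: R_def scalar_prod_self_nonneg)
  have c_le: "c * (v \<bullet> v) \<le> v \<bullet> (M *\<^sub>v v)" if v: "v \<in> carrier_vec n" for v
  proof (cases "v = 0\<^sub>v n")
    case False
    then have "c \<le> (v \<bullet> (M *\<^sub>v v)) / (v \<bullet> v)"
      unfolding c_def using v bdd by (intro cInf_lower) (auto simp: R_def)
    moreover have "v \<bullet> v > 0"
      using False scalar_prod_self_eq_0_iff[OF v] scalar_prod_self_nonneg[of v] by linarith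
    ultimately show ?thesis by (simp add: field_simps)
  qed (use M in auto)
  have B: "B \<in> carrier_mat n n" unfolding B_def using M by (intro minus_carrier_mat) auto
  have Bv: "B *\<^sub>v v = M *\<^sub>v v - c \<cdot>\<^sub>v v" if "v \<in> carrier_vec n" for v
  proof -
    have "(c \<cdot>\<^sub>m 1\<^sub>m n) *\<^sub>v v = c \<cdot>\<^sub>v v"
      using that by (intro eq_vecI) auto
    then show ?thesis
      using M that unfolding B_def
      by (subst minus_mult_distrib_mat_vec[of _ n n]) auto
  qed
  have vBv: "v \<bullet> (B *\<^sub>v v) = v \<bullet> (M *\<^sub>v v) - c * (v \<bullet> v)" if "v \<in> carrier_vec n" for v
    using M that by (simp add: Bv scalar_prod_minus_distrib[of _ n])
  have symB: "transpose_mat B = B"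
  proof -
    have "transpose_mat (c \<cdot>\<^sub>m 1\<^sub>m n) = c \<cdot>\<^sub>m 1\<^sub>m n"
      by (intro eq_matI) auto
    then show ?thesis
      using sym M unfolding B_def by (subst transpose_minus[of _ n n]) auto
  qed
  have "\<exists>v. v \<in> carrier_vec n \<and> v \<noteq> 0\<^sub>v n \<and> B *\<^sub>v v = 0\<^sub>v n"
  proof (rule ccontr)
    assume "\<not> ?thesis"
    then have "det B \<noteq> 0" using det_0_iff_vec_prod_zero_field[OF B] by blast
    from det_non_zero_imp_unit[OF B this, of "()"]
    obtain D where D: "D \<in> carrier_mat n n" and DB: "D * B = 1\<^sub>m n"
      by (auto simp: Units_def ring_mat_def)
    obtain K1 where K1: "K1 > 0"
      "\<And>v. v \<in> carrier_vec n \<Longrightarrow> (B *\<^sub>v v) \<bullet> (B *\<^sub>v v) \<le> K1 * (v \<bullet> (B *\<^sub>v v))"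
      using psd_image_bound[OF B symB] vBv c_le by (metis diff_ge_0_iff_ge)
    obtain K2 where K2: "K2 > 0"
      "\<And>v. v \<in> carrier_vec n \<Longrightarrow> (D *\<^sub>v v) \<bullet> (D *\<^sub>v v) \<le> K2 * (v \<bullet> v)"
      using mult_mat_vec_bounded[OF D] by blast
    \<comment> \<open>A fixed gap above the infimum: \<open>v \<bullet> v\<close> is at most
      \<open>K2\<close> times the squared length of \<open>B v\<close>, which is at most
      \<open>K1\<close> times the form of \<open>B\<close> at \<open>v\<close>.\<close>
    have "c + 1 / (K1 * K2) \<le> r" if r_R: "r \<in> R" for r
    proof -
      obtain v where v: "v \<in> carrier_vec n" "v \<noteq> 0\<^sub>v n" and r: "r = (v \<bullet> (M *\<^sub>v v)) / (v \<bullet> v)"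
        using r_R by (auto simp: R_def)
      have pos: "v \<bullet> v > 0"
        using v scalar_prod_self_eq_0_iff[OF v(1)] scalar_prod_self_nonneg[of v] by linarith
      have "v = D *\<^sub>v (B *\<^sub>v v)"
        using D B v(1) DB by (metis assoc_mult_mat_vec one_mult_mat_vec)
      then have "v \<bullet> v \<le> K2 * ((B *\<^sub>v v) \<bullet> (B *\<^sub>v v))"
        using K2(2)[of "B *\<^sub>v v"] B v(1) by auto
      also have "\<dots> \<le> K2 * (K1 * (v \<bullet> (B *\<^sub>v v)))"
        using K1(2)[OF v(1)] K2(1) by simp
      finally have "v \<bullet> v \<le> K2 * (K1 * (v \<bullet> (M *\<^sub>v v) - c * (v \<bullet> v)))"
        using vBv[OF v(1)] by simp
      then show ?thesis
        using pos K1(1) K2(1) by (simp add: r field_simps)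
    qed
    then have "c + 1 / (K1 * K2) \<le> c"
      unfolding c_def by (intro cInf_greatest[OF R_ne])
    then show False using K1(1) K2(1) by (simp add: field_simps)
  qed
  then obtain v where v: "v \<in> carrier_vec n" "v \<noteq> 0\<^sub>v n" and "B *\<^sub>v v = 0\<^sub>v n" by blast
  then have eq: "M *\<^sub>v v - c \<cdot>\<^sub>v v = 0\<^sub>v n" using Bv by simp
  have "M *\<^sub>v v = c \<cdot>\<^sub>v v"
  proof (rule eq_vecI)
    fix i assume "i < dim_vec (c \<cdot>\<^sub>v v)"
    then show "(M *\<^sub>v v) $ i = (c \<cdot>\<^sub>v v) $ i"
      using arg_cong[OF eq, of "\<lambda>w. w $ i"] M v by simp
  qed (use M v in simp)
  then have "eigenvalue M c"
    using v M by (auto simp: eigenvalue_def eigenvector_def)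
  then show ?thesis using that c_le by blast
qed

lemma gram_mat_quadratic_form:
  fixes A :: "real mat"
  assumes A: "A \<in> carrier_mat m n" and v: "v \<in> carrier_vec n"
  shows "v \<bullet> ((transpose_mat A * A) *\<^sub>v v) = (A *\<^sub>v v) \<bullet> (A *\<^sub>v v)"
proof -
  have At: "transpose_mat A \<in> carrier_mat n m" using A by simp
  have "(transpose_mat A * A) *\<^sub>v v = transpose_mat A *\<^sub>v (A *\<^sub>v v)"
    by (rule assoc_mult_mat_vec[OF At A v])
  then show ?thesis
    using transpose_vec_mult_scalar[OF A v, of "A *\<^sub>v v"] A v
    by (simp add: comm_scalar_prod[of v n])
qed

text \<open>A \<open>Min\<close> says something only over a finite nonempty set: the eigenvalues of
  the Gram matrix are finite in number as roots of its characteristic polynomial, and the minimum of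
  the Rayleigh quotient provides one, \<open>c\<close>. Since
  \<open>sigma_min A \<le> sqrt c\<close>, the Rayleigh bound with \<open>c\<close> gives the
  inequality; injectivity makes every eigenvalue positive.\<close>

lemma
  fixes A :: "real mat"
  assumes A: "A \<in> carrier_mat m n" and n: "n > 0"
    and inj: "\<And>v. v \<in> carrier_vec n \<Longrightarrow> A *\<^sub>v v = 0\<^sub>v m \<Longrightarrow> v = 0\<^sub>v n"
  shows sigma_min_pos: "sigma_min A > 0"
    and sigma_min_le: "v \<in> carrier_vec n \<Longrightarrow> sigma_min A * vec_l2 v \<le> vec_l2 (A *\<^sub>v v)"
proof -
  define G where "G = transpose_mat A * A"
  have G: "G \<in> carrier_mat n n" using A by (simp add: G_def)
  have symG: "transpose_mat G = G"
    using A by (simp add: G_def transpose_mult[of _ n m])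
  have form: "v \<bullet> (G *\<^sub>v v) = (A *\<^sub>v v) \<bullet> (A *\<^sub>v v)" if "v \<in> carrier_vec n" for v
    unfolding G_def by (rule gram_mat_quadratic_form[OF A that])
  obtain c where c: "eigenvalue G c"
    "\<And>v. v \<in> carrier_vec n \<Longrightarrow> c * (v \<bullet> v) \<le> v \<bullet> (G *\<^sub>v v)"
    using symmetric_mat_least_eigenvalue[OF G symG n] form by (metis scalar_prod_self_nonneg)
  have pos: "e > 0" if ev: "eigenvalue G e" for e
  proof -
    obtain v where "eigenvector G v e" using ev unfolding eigenvalue_def by blast
    then have v: "v \<in> carrier_vec n" "v \<noteq> 0\<^sub>v n" "G *\<^sub>v v = e \<cdot>\<^sub>v v"
      using carrier_matD(1)[OF G] unfolding eigenvector_def by metis+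
    have Av: "A *\<^sub>v v \<in> carrier_vec m" using A v by simp
    have "(A *\<^sub>v v) \<bullet> (A *\<^sub>v v) = e * (v \<bullet> v)"
      using form[OF v(1)] v by simp
    moreover have "(A *\<^sub>v v) \<bullet> (A *\<^sub>v v) > 0"
      using inj v scalar_prod_self_eq_0_iff[OF Av] scalar_prod_self_nonneg[of "A *\<^sub>v v"] by force
    ultimately show ?thesis
      using scalar_prod_self_nonneg[of v] by (simp add: zero_less_mult_iff)
  qed
  define E where "E = {sqrt e |e. eigenvalue G e}"
  have "char_poly G \<noteq> 0"
    using degree_monic_char_poly[OF G] n by auto
  then have "finite {e. eigenvalue G e}"
    unfolding eigenvalue_root_char_poly[OF G] by (rule poly_roots_finite)
  then have fin: "finite E" unfolding E_def by simp
  have ne: "E \<noteq> {}" using c(1) by (auto simp: E_def)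
  have sm: "sigma_min A = Min E" by (simp add: sigma_min_def E_def G_def)
  show sp: "sigma_min A > 0"
    using Min_in[OF fin ne] pos by (auto simp: sm E_def)
  assume v: "v \<in> carrier_vec n"
  have "sigma_min A \<le> sqrt c"
    unfolding sm using c(1) fin by (intro Min_le) (auto simp: E_def)
  then have "(sigma_min A * vec_l2 v)\<^sup>2 \<le> (sqrt c * vec_l2 v)\<^sup>2"
    using sp by (intro power_mono mult_right_mono) auto
  also have "\<dots> = c * (v \<bullet> v)"
    using pos[OF c(1)] by (simp add: power_mult_distrib vec_l2_power2)
  also have "\<dots> \<le> (vec_l2 (A *\<^sub>v v))\<^sup>2"
    using c(2)[OF v] form[OF v] by (simp add: vec_l2_power2)
  finally show "sigma_min A * vec_l2 v \<le> vec_l2 (A *\<^sub>v v)"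
    by (rule power2_le_imp_le) simp
qed

text \<open>Injectivity makes the Gram matrix \<open>G\<close> invertible, and the inverse of
  \<open>G\<close> times the transpose of \<open>A\<close> satisfies the four Penrose equations. As
  \<open>pseudoinverse\<close> is a definite description, uniqueness is proved as well before this
  candidate can be identified with it.\<close>

lemma
  fixes A :: "real mat"
  assumes A: "A \<in> carrier_mat m n"
    and inj: "\<And>v. v \<in> carrier_vec n \<Longrightarrow> A *\<^sub>v v = 0\<^sub>v m \<Longrightarrow> v = 0\<^sub>v n"
  shows pseudoinverse_carrier: "pseudoinverse A \<in> carrier_mat n m"
    and pseudoinverse_left_inverse: "pseudoinverse A * A = 1\<^sub>m n"
proof -
  define G where "G = transpose_mat A * A"
  have At: "transpose_mat A \<in> carrier_mat n m" using A by simp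
  have G: "G \<in> carrier_mat n n" using A by (simp add: G_def)
  have symG: "transpose_mat G = G"
    using A by (simp add: G_def transpose_mult[of _ n m])
  have injG: "v = 0\<^sub>v n" if v: "v \<in> carrier_vec n" "G *\<^sub>v v = 0\<^sub>v n" for v
  proof -
    have "(A *\<^sub>v v) \<bullet> (A *\<^sub>v v) = 0"
      using gram_mat_quadratic_form[OF A v(1)] v by (simp add: G_def)
    then have "A *\<^sub>v v = 0\<^sub>v m"
      using scalar_prod_self_eq_0_iff[of "A *\<^sub>v v" m] A v(1) by simp
    then show ?thesis using inj v(1) by blast
  qed
  then have "det G \<noteq> 0" using det_0_iff_vec_prod_zero_field[OF G] by blast
  from det_non_zero_imp_unit[OF G this, of "()"]
  obtain H where H: "H \<in> carrier_mat n n" and HG: "H * G = 1\<^sub>m n" and GH: "G * H = 1\<^sub>m n"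
    by (auto simp: Units_def ring_mat_def)
  have symH: "transpose_mat H = H"
  proof -
    have Ht: "transpose_mat H \<in> carrier_mat n n" using H by simp
    have "transpose_mat H * G = 1\<^sub>m n"
      using arg_cong[OF GH, of transpose_mat] H G symG by (simp add: transpose_mult[of _ n n])
    then have "transpose_mat H * (G * H) = H"
      using assoc_mult_mat[OF Ht G H] H by simp
    then show ?thesis using GH Ht by simp
  qed
  define Q where "Q = H * transpose_mat A"
  have Q: "Q \<in> carrier_mat n m" using H A by (simp add: Q_def)
  have QA: "Q * A = 1\<^sub>m n"
    using HG assoc_mult_mat[OF H At A] by (simp add: Q_def G_def)
  have AQ: "A * Q \<in> carrier_mat m m" using A Q by simp
  have symAQ: "transpose_mat (A * Q) = A * Q"
    unfolding Q_def transpose_mult[OF A mult_carrier_mat[OF H At]] transpose_mult[OF H At] symH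
    using assoc_mult_mat[OF A H At] by simp
  have Qpi: "is_pseudoinverse A Q"
    unfolding is_pseudoinverse_def
    using A Q QA symAQ assoc_mult_mat[OF A Q A] by simp
  have uniq: "R = Q" if "is_pseudoinverse A R" for R
  proof -
    have R: "R \<in> carrier_mat n m" and ARA: "A * R * A = A" and RAR: "R * A * R = R"
      and symAR: "transpose_mat (A * R) = A * R"
      using that A by (auto simp: is_pseudoinverse_def)
    have AR: "A * R \<in> carrier_mat m m" and RA': "R * A \<in> carrier_mat n n"
      using A R by simp_all
    \<comment> \<open>Any pseudoinverse \<open>R\<close> is again a left inverse: the left side is
      \<open>Q * A\<close>, hence the identity.\<close>
    have "Q * (A * R * A) = Q * A * (R * A)"
      unfolding assoc_mult_mat[OF A R A] assoc_mult_mat[OF Q A RA'] ..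
    then have RA: "R * A = 1\<^sub>m n"
      using ARA QA left_mult_one_mat[OF RA'] by simp
    \<comment> \<open>Both \<open>A * Q\<close> and \<open>A * R\<close> are symmetric and fix the
      range of \<open>A\<close>; transposing their product exchanges the factors, which identifies
      them.\<close>
    have "A * R = A * Q * A * R"
      unfolding assoc_mult_mat[OF A Q A] QA using A by simp
    also have "\<dots> = A * Q * (A * R)"
      by (rule assoc_mult_mat[OF AQ A R])
    also have "\<dots> = transpose_mat (A * R * (A * Q))"
      unfolding transpose_mult[OF AR AQ] symAQ symAR ..
    also have "A * R * (A * Q) = A * R * A * Q"
      by (rule assoc_mult_mat[OF AR A Q, symmetric])
    also have "\<dots> = A * Q"
      unfolding ARA ..
    finally have eq: "A * R = A * Q"
      unfolding symAQ .
    have "R = R * (A * R)"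
      using RAR assoc_mult_mat[OF R A R] by simp
    also have "\<dots> = R * A * Q"
      unfolding eq by (rule assoc_mult_mat[OF R A Q, symmetric])
    finally show "R = Q" using RA Q by simp
  qed
  have "pseudoinverse A = Q"
    unfolding pseudoinverse_def using Qpi uniq by (rule the_equality)
  then show "pseudoinverse A \<in> carrier_mat n m" "pseudoinverse A * A = 1\<^sub>m n"
    using Q QA by auto
qed

section \<open>Restricted eigenvalues on the cone\<close>

lemma vec_l2_conv_L2_set: "vec_l2 v = L2_set (\<lambda>i. v $ i) {..<dim_vec v}"
  by (simp add: vec_l2_def L2_set_def)

lemma vec_l2_triangle:
  "u \<in> carrier_vec n \<Longrightarrow> v \<in> carrier_vec n \<Longrightarrow> vec_l2 (u + v) \<le> vec_l2 u + vec_l2 v"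
  using L2_set_triangle_ineq[of "\<lambda>i. u $ i" "\<lambda>i. v $ i" "{..<n}"]
  by (simp add: vec_l2_conv_L2_set L2_set_def)

lemma vec_l2_le_vec_l1: "vec_l2 v \<le> vec_l1 v"
  unfolding vec_l2_conv_L2_set vec_l1_def by (rule L2_set_le_sum_abs)

lemma sum_abs_le_sqrt_card:
  fixes f :: "'a \<Rightarrow> real"
  shows "(\<Sum>i\<in>I. \<bar>f i\<bar>) \<le> sqrt (real (card I)) * sqrt (\<Sum>i\<in>I. (f i)\<^sup>2)"
  using sum_squared_le_sum_of_squares[of "\<lambda>i. \<bar>f i\<bar>" I]
  by (simp add: real_le_rsqrt real_sqrt_mult[symmetric] mult.commute)

lemma vec_l1_le: "vec_l1 v \<le> sqrt (real (dim_vec v)) * vec_l2 v"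
  using sum_abs_le_sqrt_card[of "\<lambda>i. v $ i" "{..<dim_vec v}"] by (simp add: vec_l1_def vec_l2_def)

lemma vec_l1_restrict: "vec_l1 (restrict_vec h T) = (\<Sum>i\<in>{..<dim_vec h} \<inter> T. \<bar>h $ i\<bar>)"
  by (simp add: vec_l1_def restrict_vec_def sum.inter_restrict if_distrib[of abs] cong: if_cong)

lemma vec_l2_restrict_power2: "(vec_l2 (restrict_vec h T))\<^sup>2 = (\<Sum>i\<in>{..<dim_vec h} \<inter> T. (h $ i)\<^sup>2)"
  by (simp add: vec_l2_def restrict_vec_def sum.inter_restrict sum_nonneg if_distrib[of power2] cong: if_cong)

lemma vec_l1_restrict_split:
  "vec_l1 h = vec_l1 (restrict_vec h T) + vec_l1 (restrict_vec h (- T))"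
proof -
  have "{..<dim_vec h} = ({..<dim_vec h} \<inter> T) \<union> ({..<dim_vec h} \<inter> - T)" by blast
  then show ?thesis
    unfolding vec_l1_restrict unfolding vec_l1_def
    by (subst sum.union_disjoint[symmetric]) auto
qed

lemma vec_l1_restrict_le:
  assumes "finite T" "card T \<le> S"
  shows "vec_l1 (restrict_vec h T) \<le> sqrt (real S) * vec_l2 (restrict_vec h T)"
proof -
  let ?I = "{..<dim_vec h} \<inter> T"
  have "card ?I \<le> S" using assms card_mono[of T ?I] by simp
  then have "sqrt (real (card ?I)) * sqrt (\<Sum>i\<in>?I. (h $ i)\<^sup>2) \<le> sqrt (real S) * sqrt (\<Sum>i\<in>?I. (h $ i)\<^sup>2)"
    by (intro mult_right_mono real_sqrt_le_mono) (auto simp: sum_nonneg)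
  moreover have "sqrt (\<Sum>i\<in>?I. (h $ i)\<^sup>2) = vec_l2 (restrict_vec h T)"
    unfolding vec_l2_restrict_power2[symmetric] by simp
  ultimately show ?thesis
    using sum_abs_le_sqrt_card[of "\<lambda>i. h $ i" ?I] unfolding vec_l1_restrict by simp
qed

text \<open>The l2 norm is at most the l1 norm, the cone condition bounds the latter by twice its
  part on \<open>T0\<close>, and Cauchy-Schwarz over at most \<open>S\<close> entries returns to l2.
  This costs the \<open>sqrt S\<close> that the bound through \<open>kappa2\<close> avoids.\<close>

lemma cone_vec_l2_le:
  assumes "in_cone h T0" and T0: "finite T0" "card T0 \<le> S"
  shows "vec_l2 h \<le> 2 * sqrt (real S) * vec_l2 (restrict_vec h T0)"
proof -
  have "vec_l2 h \<le> 2 * vec_l1 (restrict_vec h T0)"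
    using vec_l2_le_vec_l1[of h] vec_l1_restrict_split[of h T0] assms(1) by (simp add: in_cone_def)
  then show ?thesis using vec_l1_restrict_le[OF T0, of h] by simp
qed

text \<open>The entries outside \<open>T0 \<union> T1\<close> are at most the average of the entries in \<open>T1\<close>, which turns
  the \<open>\<ell>\<^sub>1\<close> cone condition into an \<open>\<ell>\<^sub>2\<close> bound on them.\<close>

lemma cone_vec_l2_le_largest:
  assumes cone: "in_cone h T0" and T0: "finite T0" "card T0 \<le> S" and S: "S \<ge> 1"
    and T1: "largest_outside h T0 S T1"
  shows "vec_l2 h \<le> 2 * vec_l2 (restrict_vec h (T0 \<union> T1))"
proof -
  let ?U = "{..<dim_vec h}"
  define T2 where "T2 = ?U - (T0 \<union> T1)"
  define c where "c = vec_l1 (restrict_vec h T0)"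
  define a where "a = (\<Sum>i\<in>T1. \<bar>h $ i\<bar>)"
  define b where "b = (\<Sum>i\<in>T2. \<bar>h $ i\<bar>)"
  have T1': "T1 \<subseteq> ?U - T0" "card T1 = S" "\<And>i j. i \<in> T1 \<Longrightarrow> j \<in> T2 \<Longrightarrow> \<bar>h $ j\<bar> \<le> \<bar>h $ i\<bar>"
    using T1 by (auto simp: largest_outside_def T2_def)
  have finT1: "finite T1" using T1'(1) finite_subset by blast
  have ab: "a \<ge> 0" "b \<ge> 0" "c \<ge> 0" by (simp_all add: a_def b_def c_def sum_nonneg)
  have "a + b = vec_l1 (restrict_vec h (- T0))"
  proof -
    have "?U \<inter> - T0 = T1 \<union> T2" using T1'(1) by (auto simp: T2_def)
    then show ?thesis
      unfolding vec_l1_restrict a_def b_def using finT1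
      by (subst sum.union_disjoint[symmetric]) (auto simp: T2_def)
  qed
  then have abc: "a + b \<le> c" using cone by (simp add: in_cone_def c_def)
  have "real S * \<bar>h $ j\<bar> \<le> a" if "j \<in> T2" for j
    unfolding a_def T1'(2)[symmetric] using T1'(3) that by (intro sum_bounded_below) auto
  then have "(\<Sum>j\<in>T2. \<bar>h $ j\<bar> * (real S * \<bar>h $ j\<bar>)) \<le> (\<Sum>j\<in>T2. \<bar>h $ j\<bar> * a)"
    by (intro sum_mono mult_left_mono) auto
  moreover have "\<bar>h $ j\<bar> * (real S * \<bar>h $ j\<bar>) = real S * (h $ j)\<^sup>2" for j
    by (simp add: power2_eq_square mult.left_commute)
  ultimately have "real S * (\<Sum>j\<in>T2. (h $ j)\<^sup>2) \<le> b * a"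
    by (simp add: b_def sum_distrib_left[symmetric] sum_distrib_right[symmetric])
  \<comment> \<open>Both \<open>a\<close> and \<open>b\<close> are nonnegative with sum at most
    \<open>c\<close>, so each is at most \<open>c\<close>.\<close>
  also have "\<dots> \<le> c * c"
    using ab abc by (intro mult_mono) auto
  also have "\<dots> \<le> (sqrt (real S) * vec_l2 (restrict_vec h T0))\<^sup>2"
    unfolding power2_eq_square c_def using vec_l1_restrict_le[OF T0, of h] by (intro mult_mono) auto
  finally have T2_le: "(\<Sum>j\<in>T2. (h $ j)\<^sup>2) \<le> (vec_l2 (restrict_vec h T0))\<^sup>2"
    using S by (simp add: power_mult_distrib)
  let ?V = "?U \<inter> (T0 \<union> T1)"
  have "(vec_l2 (restrict_vec h T0))\<^sup>2 \<le> (vec_l2 (restrict_vec h (T0 \<union> T1)))\<^sup>2"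
    unfolding vec_l2_restrict_power2 by (intro sum_mono2) auto
  moreover have "(vec_l2 h)\<^sup>2 = (\<Sum>i\<in>?V. (h $ i)\<^sup>2) + (\<Sum>j\<in>T2. (h $ j)\<^sup>2)"
  proof -
    have "?U = ?V \<union> T2" by (auto simp: T2_def)
    moreover have "(vec_l2 h)\<^sup>2 = (\<Sum>i\<in>?U. (h $ i)\<^sup>2)" by (simp add: vec_l2_def sum_nonneg)
    ultimately show ?thesis by (subst sum.union_disjoint[symmetric]) (auto simp: T2_def)
  qed
  ultimately have "(vec_l2 h)\<^sup>2 \<le> 2 * (vec_l2 (restrict_vec h (T0 \<union> T1)))\<^sup>2"
    using T2_le by (simp add: vec_l2_restrict_power2)
  \<comment> \<open>The factor \<open>sqrt 2\<close> is rounded up to 2, so that both restricted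
    eigenvalues feed the same final estimate.\<close>
  also have "\<dots> \<le> (2 * vec_l2 (restrict_vec h (T0 \<union> T1)))\<^sup>2"
    by (simp add: power_mult_distrib)
  finally show ?thesis by (rule power2_le_imp_le) simp
qed

text \<open>Greedy choice: each step adds a maximal remaining element, with ties broken
  arbitrarily.\<close>

lemma obtain_largest_subset:
  fixes f :: "'a \<Rightarrow> real"
  assumes "finite U" "k \<le> card U"
  obtains T where "T \<subseteq> U" "card T = k" "\<And>i j. i \<in> T \<Longrightarrow> j \<in> U - T \<Longrightarrow> f j \<le> f i"
  using assms(2)
proof (induction k arbitrary: thesis)
  case 0
  show ?case by (rule 0(1)[of "{}"]) auto
next
  case (Suc k)
  then obtain T where T: "T \<subseteq> U" "card T = k" "\<And>i j. i \<in> T \<Longrightarrow> j \<in> U - T \<Longrightarrow> f j \<le> f i"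
    by (metis Suc_leD)
  have "finite T" using T(1) assms(1) finite_subset by blast
  have "U - T \<noteq> {}"
    using card_mono[OF \<open>finite T\<close>, of U] T(2) Suc.prems(2) by auto
  then obtain m where m: "m \<in> U - T" "Max (f ` (U - T)) = f m"
    using assms(1) by (metis finite_Diff obtains_MAX)
  have m_max: "f j \<le> f m" if "j \<in> U - T" for j
    unfolding m(2)[symmetric] using assms(1) that by (intro Max_ge) auto
  show ?case
  proof (rule Suc.prems(1)[of "insert m T"])
    show "card (insert m T) = Suc k" using m T \<open>finite T\<close> by simp
    fix i j assume "i \<in> insert m T" "j \<in> U - insert m T"
    then show "f j \<le> f i" using m(1) m_max T(3) by auto
  qed (use m(1) T(1) in auto)
qed

text \<open>The room condition on \<open>card T0 + k\<close> is where \<open>2 * S \<le> L\<close>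
  enters: it guarantees enough indices outside \<open>T0\<close> for the set \<open>T1\<close> in
  \<open>kappa2\<close>.\<close>

lemma exists_largest_outside:
  assumes "T0 \<subseteq> {..<dim_vec h}" "card T0 + k \<le> dim_vec h"
  obtains T1 where "largest_outside h T0 k T1"
proof -
  have "finite T0" using assms(1) finite_subset by blast
  then have "k \<le> card ({..<dim_vec h} - T0)"
    using assms by (simp add: card_Diff_subset)
  then obtain T where "T \<subseteq> {..<dim_vec h} - T0" "card T = k"
    "\<And>i j. i \<in> T \<Longrightarrow> j \<in> {..<dim_vec h} - T0 - T \<Longrightarrow> \<bar>h $ j\<bar> \<le> \<bar>h $ i\<bar>"
    using obtain_largest_subset[of "{..<dim_vec h} - T0" k "\<lambda>i. \<bar>h $ i\<bar>"] by auto
  then show ?thesis by (intro that[of T]) (auto simp: largest_outside_def)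
qed

text \<open>Only the lower-bound property of the infimum is used, with 0 bounding the quotients from
  below. Clearing the denominator covers a vanishing restriction too.\<close>

lemma kappa1_le:
  assumes "T0 \<subseteq> {..<dim_col V}" "card T0 \<le> S" "h \<in> carrier_vec (dim_col V)" "in_cone h T0"
  shows "kappa1 V S * vec_l2 (restrict_vec h T0) \<le> vec_l2 (V *\<^sub>v h) / sqrt (real (dim_row V))"
proof (cases "vec_l2 (restrict_vec h T0) = 0")
  case False
  then have "vec_l2 (restrict_vec h T0) > 0"
    using vec_l2_nonneg[of "restrict_vec h T0"] by linarith
  moreover have "kappa1 V S \<le> vec_l2 (V *\<^sub>v h) / (sqrt (real (dim_row V)) * vec_l2 (restrict_vec h T0))"
    unfolding kappa1_def
  proof (rule cInf_lower, goal_cases)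
    case 1
    show ?case using assms by blast
  next
    case 2
    show ?case by (rule bdd_belowI[of _ 0]) (elim CollectE exE conjE, simp)
  qed
  ultimately show ?thesis by (simp only: pos_le_divide_eq[symmetric] divide_divide_eq_left)
qed simp

lemma kappa2_le:
  assumes "T0 \<subseteq> {..<dim_col V}" "card T0 \<le> S" "h \<in> carrier_vec (dim_col V)" "in_cone h T0"
    and "largest_outside h T0 S' T1"
  shows "kappa2 V S S' * vec_l2 (restrict_vec h (T0 \<union> T1)) \<le> vec_l2 (V *\<^sub>v h) / sqrt (real (dim_row V))"
proof (cases "vec_l2 (restrict_vec h (T0 \<union> T1)) = 0")
  case False
  then have "vec_l2 (restrict_vec h (T0 \<union> T1)) > 0"
    using vec_l2_nonneg[of "restrict_vec h (T0 \<union> T1)"] by linarith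
  moreover have "kappa2 V S S'
      \<le> vec_l2 (V *\<^sub>v h) / (sqrt (real (dim_row V)) * vec_l2 (restrict_vec h (T0 \<union> T1)))"
    unfolding kappa2_def
  proof (rule cInf_lower, goal_cases)
    case 1
    show ?case using assms by blast
  next
    case 2
    show ?case by (rule bdd_belowI[of _ 0]) (elim CollectE exE conjE, simp)
  qed
  ultimately show ?thesis by (simp only: pos_le_divide_eq[symmetric] divide_divide_eq_left)
qed simp

text \<open>While \<open>in_cone\<close> excludes the zero vector, the estimator may hit its target
  exactly. Hence only the cone inequality is assumed, and \<open>h = 0\<close> is treated
  apart.\<close>

lemma kappa1_vec_l2_le:
  assumes T0: "T0 \<subseteq> {..<dim_col V}" "card T0 \<le> S" and h: "h \<in> carrier_vec (dim_col V)"
    and cone: "vec_l1 (restrict_vec h (- T0)) \<le> vec_l1 (restrict_vec h T0)" and \<kappa>: "kappa1 V S \<ge> 0"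
  shows "kappa1 V S * vec_l2 h \<le> 2 * sqrt (real S) * (vec_l2 (V *\<^sub>v h) / sqrt (real (dim_row V)))"
proof (cases "h = 0\<^sub>v (dim_col V)")
  case True
  then have "vec_l2 h = 0" by (simp add: vec_l2_def)
  then show ?thesis by simp
next
  case False
  then have cone: "in_cone h T0" using cone h by (simp add: in_cone_def)
  have "finite T0" using T0(1) finite_subset by blast
  from cone_vec_l2_le[OF cone this T0(2)]
  have "kappa1 V S * vec_l2 h \<le> 2 * sqrt (real S) * (kappa1 V S * vec_l2 (restrict_vec h T0))"
    using mult_left_mono[OF _ \<kappa>] by (metis mult.left_commute)
  also have "\<dots> \<le> 2 * sqrt (real S) * (vec_l2 (V *\<^sub>v h) / sqrt (real (dim_row V)))"
    by (intro mult_left_mono kappa1_le T0 h cone) simp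
  finally show ?thesis .
qed

lemma kappa2_vec_l2_le:
  assumes T0: "T0 \<subseteq> {..<dim_col V}" "card T0 \<le> S" and h: "h \<in> carrier_vec (dim_col V)"
    and cone: "vec_l1 (restrict_vec h (- T0)) \<le> vec_l1 (restrict_vec h T0)" and \<kappa>: "kappa2 V S S \<ge> 0"
    and S: "1 \<le> S" "2 * S \<le> dim_col V"
  shows "kappa2 V S S * vec_l2 h \<le> 2 * (vec_l2 (V *\<^sub>v h) / sqrt (real (dim_row V)))"
proof (cases "h = 0\<^sub>v (dim_col V)")
  case True
  then have "vec_l2 h = 0" by (simp add: vec_l2_def)
  then show ?thesis by simp
next
  case False
  then have cone: "in_cone h T0" using cone h by (simp add: in_cone_def)
  have fin: "finite T0" using T0(1) finite_subset by blast
  obtain T1 where T1: "largest_outside h T0 S T1"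
    by (rule exists_largest_outside[of T0 h S]) (use T0 S h in auto)
  from cone_vec_l2_le_largest[OF cone fin T0(2) S(1) T1]
  have "kappa2 V S S * vec_l2 h \<le> 2 * (kappa2 V S S * vec_l2 (restrict_vec h (T0 \<union> T1)))"
    using mult_left_mono[OF _ \<kappa>] by (metis mult.left_commute)
  also have "\<dots> \<le> 2 * (vec_l2 (V *\<^sub>v h) / sqrt (real (dim_row V)))"
    by (intro mult_left_mono kappa2_le T0 h cone T1) simp
  finally show ?thesis .
qed

text \<open>Off the support of \<open>v\<close> the difference is \<open>u\<close> itself. Its l1
  mass there is paid for by a loss of mass on the support, which the reverse triangle inequality
  bounds by the change on the support.\<close>

lemma l1_minimizer_cone:
  assumes u: "u \<in> carrier_vec n" and v: "v \<in> carrier_vec n" and le: "vec_l1 u \<le> vec_l1 v"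
  defines "T0 \<equiv> {i. i < n \<and> v $ i \<noteq> 0}"
  shows "vec_l1 (restrict_vec (u - v) (- T0)) \<le> vec_l1 (restrict_vec (u - v) T0)"
proof -
  let ?A = "{..<n} \<inter> T0" and ?B = "{..<n} \<inter> - T0"
  have split: "vec_l1 w = (\<Sum>i\<in>?A. \<bar>w $ i\<bar>) + (\<Sum>i\<in>?B. \<bar>w $ i\<bar>)" if "w \<in> carrier_vec n" for w
    using vec_l1_restrict_split[of w T0] that by (simp add: vec_l1_restrict)
  have "(\<Sum>i\<in>?B. \<bar>v $ i\<bar>) = 0"
    by (intro sum.neutral) (auto simp: T0_def)
  then have "(\<Sum>i\<in>?B. \<bar>u $ i\<bar>) \<le> (\<Sum>i\<in>?A. \<bar>v $ i\<bar>) - (\<Sum>i\<in>?A. \<bar>u $ i\<bar>)"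
    using le split[OF u] split[OF v] by linarith
  also have "\<dots> \<le> (\<Sum>i\<in>?A. \<bar>u $ i - v $ i\<bar>)"
    unfolding sum_subtractf[symmetric] by (intro sum_mono) linarith
  also have "(\<Sum>i\<in>?B. \<bar>u $ i\<bar>) = (\<Sum>i\<in>?B. \<bar>u $ i - v $ i\<bar>)"
    by (intro sum.cong) (auto simp: T0_def)
  finally have "(\<Sum>i\<in>?B. \<bar>u $ i - v $ i\<bar>) \<le> (\<Sum>i\<in>?A. \<bar>u $ i - v $ i\<bar>)" .
  moreover have "(\<Sum>i\<in>{..<n} \<inter> T. \<bar>(u - v) $ i\<bar>) = (\<Sum>i\<in>{..<n} \<inter> T. \<bar>u $ i - v $ i\<bar>)" for T
    using v by (intro sum.cong) auto
  ultimately show ?thesis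
    using v by (simp add: vec_l1_restrict)
qed

section \<open>The empirical norm\<close>

lemma emp_norm_conv_vec_l2: "emp_norm u = vec_l2 u / sqrt (real (dim_vec u))"
  by (simp add: emp_norm_def vec_l2_def real_sqrt_divide)

lemma emp_norm_triangle:
  "u \<in> carrier_vec n \<Longrightarrow> v \<in> carrier_vec n \<Longrightarrow> emp_norm (u + v) \<le> emp_norm u + emp_norm v"
  using vec_l2_triangle[of u n v]
  by (simp add: emp_norm_conv_vec_l2 divide_right_mono add_divide_distrib[symmetric])

lemma emp_norm_le:
  assumes "dim_vec u \<ge> 1" "c \<ge> 0" and "\<And>i. i < dim_vec u \<Longrightarrow> \<bar>u $ i\<bar> \<le> c"
  shows "emp_norm u \<le> c"
proof -
  have "(\<Sum>i<dim_vec u. (u $ i)\<^sup>2) \<le> (\<Sum>i<dim_vec u. c\<^sup>2)"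
    using assms(2,3) by (intro sum_mono) (simp add: abs_le_square_iff[symmetric])
  then have "1 / real (dim_vec u) * (\<Sum>i<dim_vec u. (u $ i)\<^sup>2) \<le> c\<^sup>2"
    using assms(1) by (simp add: field_simps)
  then show ?thesis
    unfolding emp_norm_def using assms(2) by (rule real_le_lsqrt[rotated])
qed

lemma abs_scalar_prod_le_emp_norm:
  assumes "u \<in> carrier_vec n" "v \<in> carrier_vec n" "n \<ge> 1"
  shows "\<bar>u \<bullet> v\<bar> \<le> real n * emp_norm u * emp_norm v"
  using abs_scalar_prod_le[OF assms(1,2)] assms by (simp add: emp_norm_conv_vec_l2)

section \<open>Square integrable functions\<close>

text \<open>The product is dominated by the sum of the squares. Additivity of
  \<open>L2_inner\<close> rests on this, since integrals add only for integrable functions.\<close>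

lemma L2_fun_integrable_mult:
  assumes f: "L2_fun f" and g: "L2_fun g"
  shows "integrable (lebesgue_on \<Omega>) (\<lambda>z. f z * g z)"
proof (rule Bochner_Integration.integrable_bound)
  show "integrable (lebesgue_on \<Omega>) (\<lambda>z. (f z)\<^sup>2 + (g z)\<^sup>2)"
    using f g by (auto simp: L2_fun_def)
  show "(\<lambda>z. f z * g z) \<in> borel_measurable (lebesgue_on \<Omega>)"
    using f g by (auto simp: L2_fun_def)
  have "\<bar>a * b\<bar> \<le> a\<^sup>2 + b\<^sup>2" for a b :: real
  proof -
    have "2 * \<bar>a * b\<bar> \<le> a\<^sup>2 + b\<^sup>2"
      using sum_squares_bound[of "\<bar>a\<bar>" "\<bar>b\<bar>"] by (simp add: abs_mult)
    then show ?thesis using abs_ge_zero[of "a * b"] by linarith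
  qed
  then show "AE z in lebesgue_on \<Omega>. norm (f z * g z) \<le> norm ((f z)\<^sup>2 + (g z)\<^sup>2)"
    by simp
qed

lemma L2_fun_cmult: "L2_fun f \<Longrightarrow> L2_fun (\<lambda>z. c * f z)"
  by (auto simp: L2_fun_def power_mult_distrib)

lemma L2_fun_add: "L2_fun f \<Longrightarrow> L2_fun g \<Longrightarrow> L2_fun (\<lambda>z. f z + g z)"
  using L2_fun_integrable_mult[of f g]
  by (auto simp: L2_fun_def power2_sum mult.assoc)

lemma L2_fun_diff: "L2_fun f \<Longrightarrow> L2_fun g \<Longrightarrow> L2_fun (\<lambda>z. f z - g z)"
  using L2_fun_add[of f "\<lambda>z. (- 1) * g z"] L2_fun_cmult[of g "- 1"] by simp

lemma L2_fun_sum: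
  "(\<And>j. j \<in> J \<Longrightarrow> L2_fun (f j)) \<Longrightarrow> L2_fun (\<lambda>z. \<Sum>j\<in>J. f j z)"
  by (induction J rule: infinite_finite_induct) (auto simp: L2_fun_add, auto simp: L2_fun_def)

lemma L2_norm_power2: "(L2_norm f)\<^sup>2 = L2_inner f f"
  by (simp add: L2_norm_def L2_inner_def power2_eq_square)

lemma L2_norm_nonneg [simp]: "0 \<le> L2_norm f"
  by (simp add: L2_norm_def)

lemma L2_inner_commute: "L2_inner f g = L2_inner g f"
  by (simp add: L2_inner_def mult.commute)

lemma L2_inner_add_right:
  "L2_fun f \<Longrightarrow> L2_fun g \<Longrightarrow> L2_fun h \<Longrightarrow> L2_inner f (\<lambda>z. g z + h z) = L2_inner f g + L2_inner f h"
  by (simp add: L2_inner_def distrib_left L2_fun_integrable_mult)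

lemma L2_inner_diff_right:
  "L2_fun f \<Longrightarrow> L2_fun g \<Longrightarrow> L2_fun h \<Longrightarrow> L2_inner f (\<lambda>z. g z - h z) = L2_inner f g - L2_inner f h"
  by (simp add: L2_inner_def right_diff_distrib L2_fun_integrable_mult)

lemma L2_inner_cmult_right: "L2_inner f (\<lambda>z. c * g z) = c * L2_inner f g"
  by (simp add: L2_inner_def mult.left_commute)

lemma L2_inner_sum_right:
  "L2_fun f \<Longrightarrow> (\<And>j. j \<in> J \<Longrightarrow> L2_fun (g j)) \<Longrightarrow>
    L2_inner f (\<lambda>z. \<Sum>j\<in>J. g j z) = (\<Sum>j\<in>J. L2_inner f (g j))"
  by (simp add: L2_inner_def sum_distrib_left L2_fun_integrable_mult)

lemma L2_norm_diff_power2: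
  assumes "L2_fun f" "L2_fun g"
  shows "(L2_norm (\<lambda>z. f z - g z))\<^sup>2 = (L2_norm f)\<^sup>2 - 2 * L2_inner f g + (L2_norm g)\<^sup>2"
  using assms L2_inner_commute[of "\<lambda>z. f z - g z" f] L2_inner_commute[of "\<lambda>z. f z - g z" g]
  by (simp add: L2_norm_power2 L2_fun_diff L2_inner_diff_right L2_inner_commute[of g f])

text \<open>The usual discriminant argument. Functions are not identified almost everywhere, so a
  vanishing norm of \<open>g\<close> does not give \<open>g = 0\<close> and is a case of its
  own.\<close>

lemma L2_Cauchy_Schwarz:
  assumes f: "L2_fun f" and g: "L2_fun g"
  shows "\<bar>L2_inner f g\<bar> \<le> L2_norm f * L2_norm g"
proof -
  define a b c where "a = (L2_norm f)\<^sup>2" and "b = L2_inner f g" and "c = (L2_norm g)\<^sup>2"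
  have quad: "0 \<le> a - 2 * r * b + r\<^sup>2 * c" for r
  proof -
    have "0 \<le> (L2_norm (\<lambda>z. f z - r * g z))\<^sup>2" by simp
    also have "\<dots> = a - 2 * r * b + r\<^sup>2 * c"
      unfolding L2_norm_diff_power2[OF f L2_fun_cmult[OF g]]
      using L2_inner_commute[of "\<lambda>z. r * g z" g]
      by (simp add: a_def b_def c_def L2_norm_power2 L2_inner_cmult_right) (simp add: power2_eq_square)
    finally show ?thesis .
  qed
  have "b\<^sup>2 \<le> a * c"
  proof (cases "c = 0")
    case True
    have "b = 0"
    proof (rule ccontr)
      assume "b \<noteq> 0"
      \<comment> \<open>With \<open>c = 0\<close> the quadratic is affine in \<open>r\<close>, and
        this \<open>r\<close> gives it the value -1.\<close>
      then show False using quad[of "(a + 1) / (2 * b)"] True by simp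
    qed
    then show ?thesis using True by simp
  next
    case False
    then have c: "c > 0" by (simp add: c_def)
    have "0 \<le> a - b\<^sup>2 / c"
      \<comment> \<open>The vertex of the parabola.\<close>
      using quad[of "b / c"] c by (simp add: power2_eq_square)
    then show ?thesis using c by (simp add: field_simps)
  qed
  then have "\<bar>b\<bar>\<^sup>2 \<le> (L2_norm f * L2_norm g)\<^sup>2"
    by (simp add: a_def c_def power_mult_distrib)
  then show ?thesis
    unfolding b_def by (rule power2_le_imp_le) simp
qed

lemma L2_norm_triangle:
  assumes f: "L2_fun f" and g: "L2_fun g"
  shows "L2_norm (\<lambda>z. f z + g z) \<le> L2_norm f + L2_norm g"
proof (rule power2_le_imp_le)
  have "(L2_norm (\<lambda>z. f z + g z))\<^sup>2 = (L2_norm f)\<^sup>2 + 2 * L2_inner f g + (L2_norm g)\<^sup>2"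
    using f g L2_inner_commute[of "\<lambda>z. f z + g z" f] L2_inner_commute[of "\<lambda>z. f z + g z" g]
    by (simp add: L2_norm_power2 L2_fun_add L2_inner_add_right L2_inner_commute[of g f])
  also have "\<dots> \<le> (L2_norm f + L2_norm g)\<^sup>2"
    using L2_Cauchy_Schwarz[OF f g] by (simp add: power2_sum)
  finally show "(L2_norm (\<lambda>z. f z + g z))\<^sup>2 \<le> (L2_norm f + L2_norm g)\<^sup>2" .
qed simp

lemma L2_norm_minus_commute: "L2_norm (\<lambda>z. f z - g z) = L2_norm (\<lambda>z. g z - f z)"
  by (simp add: L2_norm_def power2_commute[of "f _"])

section \<open>Linear combinations of basis functions\<close>

lemma basis_comb_eq: "basis_comb b \<eta> = (\<lambda>z. \<Sum>j<dim_vec \<eta>. \<eta> $ j * b j z)"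
  by (simp add: fun_eq_iff basis_comb_def mult.commute)

lemma L2_fun_basis_comb:
  "(\<And>j. j < dim_vec \<eta> \<Longrightarrow> L2_fun (b j)) \<Longrightarrow> L2_fun (basis_comb b \<eta>)"
  unfolding basis_comb_eq by (rule L2_fun_sum) (simp add: L2_fun_cmult)

lemma L2_inner_basis_comb:
  assumes f: "L2_fun f" and b: "\<And>j. j < dim_vec \<eta> \<Longrightarrow> L2_fun (b j)"
  shows "L2_inner f (basis_comb b \<eta>) = (\<Sum>j<dim_vec \<eta>. L2_inner f (b j) * \<eta> $ j)"
proof -
  have "L2_inner f (basis_comb b \<eta>) = (\<Sum>j<dim_vec \<eta>. L2_inner f (\<lambda>z. \<eta> $ j * b j z))"
    unfolding basis_comb_eq by (rule L2_inner_sum_right[OF f]) (simp add: L2_fun_cmult b)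
  then show ?thesis by (simp add: L2_inner_cmult_right mult.commute)
qed

text \<open>Cauchy-Schwarz at each point, then integration. This is the source of the constant
  \<open>C\<^sub>b\<close>.\<close>

lemma L2_norm_basis_comb_le:
  assumes b: "\<And>j. j < dim_vec \<eta> \<Longrightarrow> L2_fun (b j)"
  shows "L2_norm (basis_comb b \<eta>) \<le> sqrt (\<Sum>j<dim_vec \<eta>. LINT z|lebesgue_on \<Omega>. (b j z)\<^sup>2) * vec_l2 \<eta>"
proof -
  let ?s = "\<lambda>z. \<Sum>j<dim_vec \<eta>. (b j z)\<^sup>2"
  let ?e = "\<Sum>j<dim_vec \<eta>. (\<eta> $ j)\<^sup>2"
  have int: "integrable (lebesgue_on \<Omega>) (\<lambda>z. ?s z * ?e)"
    using b by (intro integrable_mult_left integrable_sum) (auto simp: L2_fun_def)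
  have "(LINT z|lebesgue_on \<Omega>. (basis_comb b \<eta> z)\<^sup>2) \<le> (LINT z|lebesgue_on \<Omega>. ?s z * ?e)"
  proof (rule integral_mono[OF _ int])
    show "integrable (lebesgue_on \<Omega>) (\<lambda>z. (basis_comb b \<eta> z)\<^sup>2)"
      using L2_fun_basis_comb[of \<eta> b] b by (simp add: L2_fun_def)
    show "(basis_comb b \<eta> z)\<^sup>2 \<le> ?s z * ?e" for z
      unfolding basis_comb_def by (rule Cauchy_Schwarz_ineq_sum)
  qed
  also have "\<dots> = (\<Sum>j<dim_vec \<eta>. LINT z|lebesgue_on \<Omega>. (b j z)\<^sup>2) * ?e"
    using b by (simp add: L2_fun_def)
  finally show ?thesis
    unfolding L2_norm_def vec_l2_def real_sqrt_mult[symmetric] by (rule real_sqrt_le_mono)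
qed

text \<open>Passes from coefficient vectors to functions, so that predictions become inner products
  with the covariates.\<close>

lemma design_mat_mult_vec:
  assumes "\<And>i. i < n \<Longrightarrow> L2_fun (x i)" "\<And>j. j < p \<Longrightarrow> L2_fun (b j)" "\<eta> \<in> carrier_vec p"
  shows "design_mat n p x b *\<^sub>v \<eta> = vec n (\<lambda>i. L2_inner (x i) (basis_comb b \<eta>))"
proof (rule eq_vecI)
  fix i assume i: "i < dim_vec (vec n (\<lambda>i. L2_inner (x i) (basis_comb b \<eta>)))"
  have "L2_inner (x i) (basis_comb b \<eta>) = (\<Sum>j<dim_vec \<eta>. L2_inner (x i) (b j) * \<eta> $ j)"
    using assms i by (intro L2_inner_basis_comb) auto
  then show "(design_mat n p x b *\<^sub>v \<eta>) $ i = vec n (\<lambda>i. L2_inner (x i) (basis_comb b \<eta>)) $ i"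
    using assms(3) i by (auto simp: design_mat_def scalar_prod_def atLeast0LessThan intro!: sum.cong)
qed (simp add: design_mat_def)

section \<open>Gaussian tails\<close>

text \<open>The cross term of the square of \<open>c + v\<close> is nonnegative and is dropped;
  allowing both signs of \<open>c\<close> serves both tails.\<close>

lemma normal_density_shift_le:
  assumes "\<tau> > 0" "0 \<le> c * v"
  shows "normal_density 0 \<tau> (c + v) \<le> exp (- (c\<^sup>2 / (2 * \<tau>\<^sup>2))) * normal_density 0 \<tau> v"
proof -
  have "- ((c + v)\<^sup>2 / (2 * \<tau>\<^sup>2)) \<le> - ((c\<^sup>2 + v\<^sup>2) / (2 * \<tau>\<^sup>2))"
    using assms by (simp add: divide_right_mono power2_sum)
  then have "exp (- ((c + v)\<^sup>2 / (2 * \<tau>\<^sup>2))) \<le> exp (- (c\<^sup>2 / (2 * \<tau>\<^sup>2))) * exp (- (v\<^sup>2 / (2 * \<tau>\<^sup>2)))"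
    by (simp add: exp_add[symmetric] add_divide_distrib)
  then have "exp (- ((c + v)\<^sup>2 / (2 * \<tau>\<^sup>2))) / sqrt (2 * pi * \<tau>\<^sup>2)
      \<le> exp (- (c\<^sup>2 / (2 * \<tau>\<^sup>2))) * exp (- (v\<^sup>2 / (2 * \<tau>\<^sup>2))) / sqrt (2 * pi * \<tau>\<^sup>2)"
    by (rule divide_right_mono) simp
  then show ?thesis
    by (simp add: normal_density_def)
qed

text \<open>Shifting each tail to the origin costs the factor \<open>exp (- u\<^sup>2 / 2)\<close> and leaves two disjoint
  half-lines of total mass one, so no factor 2 arises.\<close>

lemma (in prob_space) normal_two_sided_tail:
  assumes X: "distributed M lborel X (normal_density 0 \<tau>)" and \<tau>: "\<tau> > 0" and u: "u \<ge> 0"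
  shows "prob {\<omega> \<in> space M. u * \<tau> < \<bar>X \<omega>\<bar>} \<le> exp (- (u\<^sup>2 / 2))"
proof -
  define c where "c = u * \<tau>"
  define E where "E = exp (- (u\<^sup>2 / 2))"
  have c: "c \<ge> 0" using u \<tau> by (simp add: c_def)
  have E: "exp (- (c\<^sup>2 / (2 * \<tau>\<^sup>2))) = E"
    using \<tau> by (simp add: c_def E_def power_mult_distrib)
  let ?\<phi> = "normal_density 0 \<tau>"
  have shift: "ennreal (?\<phi> (d + v)) \<le> ennreal E * ennreal (?\<phi> v)" if "d\<^sup>2 = c\<^sup>2" "0 \<le> d * v" for d v
    using normal_density_shift_le[OF \<tau> that(2)] unfolding that(1) E
    by (subst ennreal_mult'[symmetric]) (auto simp: E_def)
  have right: "(\<integral>\<^sup>+x. ennreal (?\<phi> x) * indicator {c<..} x \<partial>lborel)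
      \<le> (\<integral>\<^sup>+x. ennreal E * (ennreal (?\<phi> x) * indicator {0<..} x) \<partial>lborel)"
  proof (subst nn_integral_real_affine[of _ 1 c])
    show "ennreal \<bar>1\<bar> * (\<integral>\<^sup>+x. ennreal (?\<phi> (c + 1 * x)) * indicator {c<..} (c + 1 * x) \<partial>lborel)
        \<le> (\<integral>\<^sup>+x. ennreal E * (ennreal (?\<phi> x) * indicator {0<..} x) \<partial>lborel)"
      using c by (auto intro!: nn_integral_mono shift split: split_indicator)
  qed auto
  have left: "(\<integral>\<^sup>+x. ennreal (?\<phi> x) * indicator {..<-c} x \<partial>lborel)
      \<le> (\<integral>\<^sup>+x. ennreal E * (ennreal (?\<phi> x) * indicator {..<0} x) \<partial>lborel)"
  proof (subst nn_integral_real_affine[of _ 1 "- c"])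
    show "ennreal \<bar>1\<bar> * (\<integral>\<^sup>+x. ennreal (?\<phi> (- c + 1 * x)) * indicator {..<-c} (- c + 1 * x) \<partial>lborel)
        \<le> (\<integral>\<^sup>+x. ennreal E * (ennreal (?\<phi> x) * indicator {..<0} x) \<partial>lborel)"
      using c shift[of "- c"]
      by (auto intro!: nn_integral_mono simp: mult_nonneg_nonpos split: split_indicator)
  qed auto
  have "emeasure M (X -` ({c<..} \<union> {..<-c}) \<inter> space M)
      = (\<integral>\<^sup>+x. ennreal (?\<phi> x) * indicator ({c<..} \<union> {..<-c}) x \<partial>lborel)"
    by (rule distributed_emeasure[OF X]) auto
  also have "\<dots> \<le> (\<integral>\<^sup>+x. ennreal (?\<phi> x) * indicator {c<..} x + ennreal (?\<phi> x) * indicator {..<-c} x \<partial>lborel)"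
    by (intro nn_integral_mono) (auto split: split_indicator)
  also have "\<dots> = (\<integral>\<^sup>+x. ennreal (?\<phi> x) * indicator {c<..} x \<partial>lborel)
      + (\<integral>\<^sup>+x. ennreal (?\<phi> x) * indicator {..<-c} x \<partial>lborel)"
    by (rule nn_integral_add) auto
  also have "\<dots> \<le> (\<integral>\<^sup>+x. ennreal E * (ennreal (?\<phi> x) * indicator {0<..} x) \<partial>lborel)
      + (\<integral>\<^sup>+x. ennreal E * (ennreal (?\<phi> x) * indicator {..<0} x) \<partial>lborel)"
    by (rule add_mono[OF right left])
  also have "\<dots> = (\<integral>\<^sup>+x. ennreal E * (ennreal (?\<phi> x) * indicator {0<..} x)
      + ennreal E * (ennreal (?\<phi> x) * indicator {..<0} x) \<partial>lborel)"
    by (rule nn_integral_add[symmetric]) auto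
  also have "\<dots> \<le> (\<integral>\<^sup>+x. ennreal E * ennreal (?\<phi> x) \<partial>lborel)"
    by (intro nn_integral_mono) (auto split: split_indicator)
  also have "\<dots> = ennreal E"
    using \<tau> by (simp add: nn_integral_cmult nn_integral_eq_integral)
  finally have "emeasure M (X -` ({c<..} \<union> {..<-c}) \<inter> space M) \<le> ennreal E" .
  moreover have "X -` ({c<..} \<union> {..<-c}) \<inter> space M = {\<omega> \<in> space M. u * \<tau> < \<bar>X \<omega>\<bar>}"
    using c by (auto simp: c_def)
  ultimately show ?thesis
    by (simp add: emeasure_eq_measure E_def)
qed

lemma (in prob_space) normal_linear_combination:
  fixes a :: "'i \<Rightarrow> real"
  assumes I: "finite I" and indep: "indep_vars (\<lambda>_. borel) \<epsilon> I"
    and normal: "\<And>i. i \<in> I \<Longrightarrow> distributed M lborel (\<epsilon> i) (normal_density 0 \<sigma>)"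
    and \<sigma>: "\<sigma> > 0" and a: "(\<Sum>i\<in>I. (a i)\<^sup>2) > 0"
  shows "distributed M lborel (\<lambda>\<omega>. \<Sum>i\<in>I. a i * \<epsilon> i \<omega>)
    (normal_density 0 (\<sigma> * sqrt (\<Sum>i\<in>I. (a i)\<^sup>2)))"
proof -
  \<comment> \<open>Summands with coefficient 0 are removed because a constant has no density; the
    positive sum of squares keeps \<open>J\<close> nonempty.\<close>
  define J where "J = {i\<in>I. a i \<noteq> 0}"
  have J: "finite J" "J \<subseteq> I" using I by (auto simp: J_def)
  have "J \<noteq> {}"
  proof
    assume "J = {}"
    then have "(\<Sum>i\<in>I. (a i)\<^sup>2) = 0" by (intro sum.neutral) (auto simp: J_def)
    then show False using a by simp
  qed
  have "indep_vars (\<lambda>_. borel) (\<lambda>i \<omega>. a i * \<epsilon> i \<omega>) J"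
    by (rule indep_vars_compose2[OF indep_vars_subset[OF indep J(2)]]) auto
  moreover have "distributed M lborel (\<lambda>\<omega>. a i * \<epsilon> i \<omega>) (normal_density 0 (\<bar>a i\<bar> * \<sigma>))" if "i \<in> J" for i
    using normal_density_affine[OF normal[of i] \<sigma>, of "a i" 0] that by (simp add: J_def)
  ultimately have "distributed M lborel (\<lambda>\<omega>. \<Sum>i\<in>J. a i * \<epsilon> i \<omega>)
      (normal_density (\<Sum>i\<in>J. 0) (sqrt (\<Sum>i\<in>J. (\<bar>a i\<bar> * \<sigma>)\<^sup>2)))"
    using \<sigma> by (intro sum_indep_normal[OF J(1) \<open>J \<noteq> {}\<close>]) (auto simp: J_def)
  moreover have "(\<Sum>i\<in>J. a i * \<epsilon> i \<omega>) = (\<Sum>i\<in>I. a i * \<epsilon> i \<omega>)" for \<omega>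
    by (rule sum.mono_neutral_left) (auto simp: J_def I)
  moreover have "(\<Sum>i\<in>J. (\<bar>a i\<bar> * \<sigma>)\<^sup>2) = \<sigma>\<^sup>2 * (\<Sum>i\<in>I. (a i)\<^sup>2)"
  proof -
    have "(\<Sum>i\<in>J. (\<bar>a i\<bar> * \<sigma>)\<^sup>2) = \<sigma>\<^sup>2 * (\<Sum>i\<in>J. (a i)\<^sup>2)"
      by (simp add: sum_distrib_left power_mult_distrib mult.commute)
    also have "(\<Sum>i\<in>J. (a i)\<^sup>2) = (\<Sum>i\<in>I. (a i)\<^sup>2)"
      by (rule sum.mono_neutral_left) (auto simp: J_def I)
    finally show ?thesis .
  qed
  ultimately show ?thesis using \<sigma> by (simp add: real_sqrt_mult)
qed

text \<open>A union bound: the combinations share their noise and may be dependent, but equal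
  variances give them a common threshold. Measurability of \<open>G\<close> is included because
  \<open>with_prob_at_least\<close> asks for a measurable event.\<close>

lemma (in prob_space) normal_linear_combinations_bound:
  fixes a :: "'j \<Rightarrow> 'i \<Rightarrow> real"
  assumes I: "finite I" and J: "finite J" and indep: "indep_vars (\<lambda>_. borel) \<epsilon> I"
    and normal: "\<And>i. i \<in> I \<Longrightarrow> distributed M lborel (\<epsilon> i) (normal_density 0 \<sigma>)"
    and \<sigma>: "\<sigma> > 0" and a: "\<And>j. j \<in> J \<Longrightarrow> (\<Sum>i\<in>I. (a j i)\<^sup>2) = \<tau>\<^sup>2"
    and \<tau>: "\<tau> > 0" and u: "u \<ge> 0"
  defines "G \<equiv> {\<omega> \<in> space M. \<forall>j\<in>J. \<bar>\<Sum>i\<in>I. a j i * \<epsilon> i \<omega>\<bar> \<le> u * \<sigma> * \<tau>}"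
  shows "G \<in> events" and "1 - real (card J) * exp (- (u\<^sup>2 / 2)) \<le> prob G"
proof -
  define Z where "Z j \<omega> = (\<Sum>i\<in>I. a j i * \<epsilon> i \<omega>)" for j \<omega>
  define B where "B j = {\<omega> \<in> space M. u * (\<sigma> * \<tau>) < \<bar>Z j \<omega>\<bar>}" for j
  have Z: "distributed M lborel (Z j) (normal_density 0 (\<sigma> * \<tau>))" if "j \<in> J" for j
  proof -
    have "(\<Sum>i\<in>I. (a j i)\<^sup>2) > 0" using a[OF that] \<tau> by simp
    from normal_linear_combination[OF I indep normal \<sigma> this] show ?thesis
      using a[OF that] \<tau> by (simp add: Z_def[abs_def])
  qed
  have B: "B j \<in> events" if "j \<in> J" for j
  proof -
    have [measurable]: "Z j \<in> borel_measurable M"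
      using Z[OF that] by (simp add: distributed_def)
    show ?thesis unfolding B_def by measurable
  qed
  have G_eq: "G = space M - (\<Union>j\<in>J. B j)"
    by (auto simp: G_def B_def Z_def not_less mult.assoc)
  have UB: "(\<Union>j\<in>J. B j) \<in> events" using B J by auto
  then show "G \<in> events" by (auto simp: G_eq)
  have "prob (\<Union>j\<in>J. B j) \<le> (\<Sum>j\<in>J. prob (B j))"
    using B by (intro finite_measure_subadditive_finite J) auto
  also have "\<dots> \<le> (\<Sum>j\<in>J. exp (- (u\<^sup>2 / 2)))"
    unfolding B_def using \<sigma> \<tau> u Z by (intro sum_mono normal_two_sided_tail) auto
  finally show "1 - real (card J) * exp (- (u\<^sup>2 / 2)) \<le> prob G"
    unfolding G_eq prob_compl[OF UB] by simp
qed

section \<open>Error of the estimator\<close>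

lemma vec_linf_le_iff:
  assumes "dim_vec v \<ge> 1"
  shows "vec_linf v \<le> c \<longleftrightarrow> (\<forall>i<dim_vec v. \<bar>v $ i\<bar> \<le> c)"
proof -
  have "(\<lambda>i. \<bar>v $ i\<bar>) ` {..<dim_vec v} \<noteq> {}" using assms by (auto simp: lessThan_empty_iff)
  then show ?thesis unfolding vec_linf_def by (subst Max_le_iff) auto
qed

lemma scaled_residual_linf_le_iff:
  fixes X :: "real mat"
  assumes X: "X \<in> carrier_mat n p" and r: "r \<in> carrier_vec n" and n: "n \<ge> 1" and p: "p \<ge> 1"
    and N: "\<And>j. j < p \<Longrightarrow> N j > 0"
  shows "vec_linf ((1 / real n) \<cdot>\<^sub>v (mat_diag p (\<lambda>j. 1 / N j) *\<^sub>v (transpose_mat X *\<^sub>v r))) \<le> lam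
    \<longleftrightarrow> (\<forall>j<p. \<bar>col X j \<bullet> r\<bar> \<le> real n * N j * lam)"
proof -
  let ?w = "(1 / real n) \<cdot>\<^sub>v (mat_diag p (\<lambda>j. 1 / N j) *\<^sub>v (transpose_mat X *\<^sub>v r))"
  have dim: "dim_vec ?w = p" by (simp add: mat_diag_def)
  have entry: "?w $ j = (col X j \<bullet> r) / (real n * N j)" if j: "j < p" for j
  proof -
    have "(mat_diag p (\<lambda>j. 1 / N j) *\<^sub>v (transpose_mat X *\<^sub>v r)) $ j
        = (\<Sum>k<p. (if j = k then 1 / N j else 0) * (col X k \<bullet> r))"
      using X j by (auto simp: mat_diag_def scalar_prod_def[of "vec _ _"] atLeast0LessThan intro!: sum.cong)
    also have "\<dots> = (col X j \<bullet> r) / N j"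
      using j by (simp add: if_distrib[of "\<lambda>x. x * _"] cong: if_cong)
    finally show ?thesis using j by (simp add: mat_diag_def mult.commute)
  qed
  have "\<bar>?w $ j\<bar> \<le> lam \<longleftrightarrow> \<bar>col X j \<bullet> r\<bar> \<le> real n * N j * lam" if j: "j < p" for j
  proof -
    have pos: "real n * N j > 0" using n N[OF j] by simp
    show ?thesis
      unfolding entry[OF j] abs_divide abs_of_pos[OF pos] pos_divide_le_eq[OF pos]
      by (simp only: mult.commute)
  qed
  then show ?thesis
    using p vec_linf_le_iff[of ?w lam] unfolding dim by blast
qed

text \<open>Duality of the sup norm and the l1 norm: the squared length of \<open>X d\<close> pairs
  the vector of products \<open>col X j \<bullet> (X *\<^sub>v d)\<close> with
  \<open>d\<close>.\<close>

lemma gram_form_le: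
  fixes X :: "real mat"
  assumes X: "X \<in> carrier_mat n p" and d: "d \<in> carrier_vec p"
    and bound: "\<And>j. j < p \<Longrightarrow> \<bar>col X j \<bullet> (X *\<^sub>v d)\<bar> \<le> B"
  shows "(vec_l2 (X *\<^sub>v d))\<^sup>2 \<le> B * vec_l1 d"
proof -
  have Xd: "X *\<^sub>v d \<in> carrier_vec n" using X d by simp
  have "(vec_l2 (X *\<^sub>v d))\<^sup>2 = (transpose_mat X *\<^sub>v (X *\<^sub>v d)) \<bullet> d"
    unfolding vec_l2_power2 by (rule transpose_vec_mult_scalar[OF X d Xd, symmetric])
  also have "\<dots> = (\<Sum>j<p. (col X j \<bullet> (X *\<^sub>v d)) * d $ j)"
    using X d by (auto simp: scalar_prod_def[of "transpose_mat X *\<^sub>v _"] atLeast0LessThan intro!: sum.cong)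
  also have "\<dots> \<le> (\<Sum>j<p. B * \<bar>d $ j\<bar>)"
  proof (rule sum_mono)
    fix j assume "j \<in> {..<p}"
    then have "\<bar>col X j \<bullet> (X *\<^sub>v d)\<bar> * \<bar>d $ j\<bar> \<le> B * \<bar>d $ j\<bar>"
      using bound by (intro mult_right_mono) auto
    then show "(col X j \<bullet> (X *\<^sub>v d)) * d $ j \<le> B * \<bar>d $ j\<bar>"
      using abs_ge_self[of "(col X j \<bullet> (X *\<^sub>v d)) * d $ j"] unfolding abs_mult by linarith
  qed
  also have "\<dots> = B * vec_l1 d"
    using d by (simp add: vec_l1_def sum_distrib_left)
  finally show ?thesis .
qed

text \<open>Here \<open>v\<close>, \<open>h\<close> and \<open>d\<close> stand for the prediction error, the error of the penalised coefficients
  and the error of the coefficients; the quadratic bound on \<open>v\<close> is closed up through \<open>h\<close>.\<close>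

lemma error_bounds_from_quadratic:
  fixes v h d :: real
  assumes quad: "v\<^sup>2 \<le> 2 * lam * K * d" and sd: "s * d \<le> h" and kh: "\<kappa> * h \<le> 2 * r * v"
    and pos: "\<kappa> > 0" "s > 0" and nn: "v \<ge> 0" "lam \<ge> 0" "K \<ge> 0" "r \<ge> 0"
  shows "v \<le> 4 * K / (\<kappa> * s) * lam * r" and "d \<le> 8 * K / (\<kappa>\<^sup>2 * s\<^sup>2) * lam * r\<^sup>2"
proof -
  have "\<kappa> * (s * d) \<le> 2 * r * v"
    using mult_left_mono[OF sd, of \<kappa>] kh pos by linarith
  then have d: "d \<le> 2 * r * v / (\<kappa> * s)"
    using pos by (simp add: pos_le_divide_eq mult_ac)
  show v: "v \<le> 4 * K / (\<kappa> * s) * lam * r"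
  \<comment> \<open>One factor \<open>v\<close> is cancelled below, so \<open>v = 0\<close> is
    separated.\<close>
  proof (cases "v = 0")
    case True
    then show ?thesis using pos nn by simp
  next
    case False
    have "v * v \<le> 2 * lam * K * (2 * r * v / (\<kappa> * s))"
      using order_trans[OF quad mult_left_mono[OF d, of "2 * lam * K"]] nn by (simp add: power2_eq_square)
    also have "\<dots> = (4 * K / (\<kappa> * s) * lam * r) * v" by simp
    finally show ?thesis using False nn(1) by (intro mult_right_le_imp_le[of v v]) auto
  qed
  have "d \<le> 2 * r * (4 * K / (\<kappa> * s) * lam * r) / (\<kappa> * s)"
    using order_trans[OF d divide_right_mono[OF mult_left_mono[OF v, of "2 * r"]]] nn pos by simp
  also have "\<dots> = 8 * K / (\<kappa>\<^sup>2 * s\<^sup>2) * lam * r\<^sup>2"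
    by (simp add: power2_eq_square mult_ac)
  finally show "d \<le> 8 * K / (\<kappa>\<^sup>2 * s\<^sup>2) * lam * r\<^sup>2" .
qed

text \<open>The deterministic core, with \<open>u\<close> for the target and \<open>u'\<close> for
  the estimator. All it takes from the random part is that both are feasible and that
  \<open>u'\<close> has the smaller penalty.\<close>

lemma
  fixes X A :: "real mat" and N :: "nat \<Rightarrow> real"
  assumes X: "X \<in> carrier_mat n p" and A: "A \<in> carrier_mat L p" and rank: "vec_space.rank L A = p"
    and n: "n \<ge> 1" and p: "p \<ge> 1" and N: "\<And>j. j < p \<Longrightarrow> N j > 0"
    and y: "y \<in> carrier_vec n" and u: "u \<in> carrier_vec p" and u': "u' \<in> carrier_vec p"
    and feas: "\<And>j. j < p \<Longrightarrow> \<bar>col X j \<bullet> (y - X *\<^sub>v u)\<bar> \<le> real n * N j * lam"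
    and feas': "\<And>j. j < p \<Longrightarrow> \<bar>col X j \<bullet> (y - X *\<^sub>v u')\<bar> \<le> real n * N j * lam"
    and le: "vec_l1 (A *\<^sub>v u') \<le> vec_l1 (A *\<^sub>v u)"
    and sparse: "card {i. i < L \<and> (A *\<^sub>v u) $ i \<noteq> 0} \<le> S" and lam: "lam \<ge> 0"
  defines "V \<equiv> X * pseudoinverse A" and "N_max \<equiv> Max (N ` {..<p})"
  shows prediction_error_kappa1: "kappa1 V S > 0 \<Longrightarrow>
      emp_norm (X *\<^sub>v (u' - u)) \<le> 4 * (sqrt (real L) * N_max) / (kappa1 V S * sigma_min A) * lam * sqrt (real S)"
    and coefficient_error_kappa1: "kappa1 V S > 0 \<Longrightarrow>
      vec_l2 (u' - u) \<le> 8 * (sqrt (real L) * N_max) / ((kappa1 V S)\<^sup>2 * (sigma_min A)\<^sup>2) * lam * real S"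
    and coefficient_error_kappa2: "kappa2 V S S > 0 \<Longrightarrow> 1 \<le> S \<Longrightarrow> 2 * S \<le> L \<Longrightarrow>
      vec_l2 (u' - u) \<le> 8 * (sqrt (real L) * N_max) / ((kappa2 V S S)\<^sup>2 * (sigma_min A)\<^sup>2) * lam"
proof -
  have inj: "v = 0\<^sub>v p" if "v \<in> carrier_vec p" "A *\<^sub>v v = 0\<^sub>v L" for v
    by (rule full_rank_imp_injective[OF A rank that])
  have pL: "p \<le> L" using rank_le_nr[OF A] rank by simp
  have p0: "p > 0" using p by simp
  define d h T0 where "d = u' - u" and "h = A *\<^sub>v u' - A *\<^sub>v u"
    and "T0 = {i. i < L \<and> (A *\<^sub>v u) $ i \<noteq> 0}"
  have d: "d \<in> carrier_vec p" using u u' by (simp add: d_def)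
  have h: "h \<in> carrier_vec L" using A u u' by (simp add: h_def)
  have h_eq: "h = A *\<^sub>v d"
    unfolding h_def d_def by (rule mult_minus_distrib_mat_vec[OF A u' u, symmetric])
  note Pinv = pseudoinverse_carrier[OF A inj] pseudoinverse_left_inverse[OF A inj]
  have V: "V \<in> carrier_mat n L" using X Pinv(1) by (simp add: V_def)
  have "V *\<^sub>v h = X *\<^sub>v (pseudoinverse A *\<^sub>v (A *\<^sub>v d))"
    unfolding V_def h_eq by (rule assoc_mult_mat_vec[OF X Pinv(1) mult_mat_vec_carrier[OF A d]])
  also have "\<dots> = X *\<^sub>v d"
    using assoc_mult_mat_vec[OF Pinv(1) A d] Pinv(2) d by simp
  finally have Vh: "V *\<^sub>v h = X *\<^sub>v d" .
  have cone: "vec_l1 (restrict_vec h (- T0)) \<le> vec_l1 (restrict_vec h T0)"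
    unfolding h_def T0_def using A u u' le by (intro l1_minimizer_cone) auto
  have N_le: "N j \<le> N_max" if "j < p" for j
    unfolding N_max_def using that by (intro Max_ge) auto
  have N_max: "N_max \<ge> 0" using N[OF p0] N_le[OF p0] by linarith
  define e where "e = vec_l2 (X *\<^sub>v d) / sqrt (real n)"
  have emp: "emp_norm (X *\<^sub>v d) = e"
    using X by (simp add: emp_norm_conv_vec_l2 e_def)
  have "\<bar>col X j \<bullet> (X *\<^sub>v d)\<bar> \<le> 2 * real n * N_max * lam" if j: "j < p" for j
  proof -
    let ?c = "col X j"
    have c: "?c \<in> carrier_vec n" using X j by auto
    have Xu: "X *\<^sub>v u \<in> carrier_vec n" "X *\<^sub>v u' \<in> carrier_vec n" using X u u' by auto
    \<comment> \<open>The data \<open>y\<close> cancel in the difference of the two residuals, and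
      the two constraints add up to the factor 2.\<close>
    have "?c \<bullet> (X *\<^sub>v d) = ?c \<bullet> (y - X *\<^sub>v u) - ?c \<bullet> (y - X *\<^sub>v u')"
      unfolding d_def mult_minus_distrib_mat_vec[OF X u' u] scalar_prod_minus_distrib[OF c Xu(2,1)]
        scalar_prod_minus_distrib[OF c y Xu(1)] scalar_prod_minus_distrib[OF c y Xu(2)] by simp
    also have "\<bar>\<dots>\<bar> \<le> 2 * (real n * N j * lam)"
      using feas[OF j] feas'[OF j] by linarith
    also have "\<dots> \<le> 2 * (real n * N_max * lam)"
      using N_le[OF j] lam by (intro mult_left_mono mult_right_mono) auto
    finally show ?thesis by simp
  qed
  from gram_form_le[OF X d this]
  have "(vec_l2 (X *\<^sub>v d))\<^sup>2 \<le> 2 * real n * N_max * lam * vec_l1 d" .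
  also have "\<dots> \<le> 2 * real n * N_max * lam * (sqrt (real L) * vec_l2 d)"
  proof (rule mult_left_mono)
    have "vec_l1 d \<le> sqrt (real p) * vec_l2 d" using vec_l1_le[of d] d by simp
    also have "\<dots> \<le> sqrt (real L) * vec_l2 d" using pL by (intro mult_right_mono) auto
    finally show "vec_l1 d \<le> sqrt (real L) * vec_l2 d" .
  qed (use N_max lam in simp)
  finally have quad: "e\<^sup>2 \<le> 2 * lam * (sqrt (real L) * N_max) * vec_l2 d"
    using n by (simp add: e_def power_divide pos_divide_le_eq mult_ac)
  have sd: "sigma_min A * vec_l2 d \<le> vec_l2 h"
    unfolding h_eq by (rule sigma_min_le[OF A p0 inj d])
  have s: "sigma_min A > 0" by (rule sigma_min_pos[OF A p0 inj])
  have e0: "e \<ge> 0" by (simp add: e_def)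
  have K: "sqrt (real L) * N_max \<ge> 0" using N_max by simp
  have T0: "T0 \<subseteq> {..<dim_col V}" "card T0 \<le> S"
    using V sparse by (auto simp: T0_def)
  have hV: "h \<in> carrier_vec (dim_col V)" using h V by simp
  { assume \<kappa>: "kappa1 V S > 0"
    have "kappa1 V S * vec_l2 h \<le> 2 * sqrt (real S) * e"
      using kappa1_vec_l2_le[OF T0 hV cone] \<kappa> V by (simp add: Vh e_def)
    from error_bounds_from_quadratic[OF quad sd this \<kappa> s e0 lam K]
    show "emp_norm (X *\<^sub>v (u' - u)) \<le> 4 * (sqrt (real L) * N_max) / (kappa1 V S * sigma_min A) * lam * sqrt (real S)"
      "vec_l2 (u' - u) \<le> 8 * (sqrt (real L) * N_max) / ((kappa1 V S)\<^sup>2 * (sigma_min A)\<^sup>2) * lam * real S"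
      unfolding d_def[symmetric] emp by simp_all }
  assume \<kappa>: "kappa2 V S S > 0" and S: "1 \<le> S" "2 * S \<le> L"
  \<comment> \<open>The explicit 1 stands in for \<open>sqrt (real S)\<close> in the common
    estimate, so this bound is free of \<open>S\<close>.\<close>
  have "kappa2 V S S * vec_l2 h \<le> 2 * 1 * e"
    using kappa2_vec_l2_le[OF T0 hV cone _ S(1)] \<kappa> V S(2) by (simp add: Vh e_def)
  from error_bounds_from_quadratic(2)[OF quad sd this \<kappa> s e0 lam K]
  show "vec_l2 (u' - u) \<le> 8 * (sqrt (real L) * N_max) / ((kappa2 V S S)\<^sup>2 * (sigma_min A)\<^sup>2) * lam"
    unfolding d_def[symmetric] by simp
qed

section \<open>Dimensions of the penalty matrix\<close>

lemma kronecker_carrier: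
  "A \<in> carrier_mat m n \<Longrightarrow> B \<in> carrier_mat m' n' \<Longrightarrow> kronecker A B \<in> carrier_mat (m * m') (n * n')"
  by (auto simp: kronecker_def)

lemma penalty_mat_carrier:
  "penalty_mat m1 m2 d1 d2 \<delta>1 \<delta>2 w p t s b
    \<in> carrier_mat (m1 * m2 + (m1 - d1) * m2 + m1 * (m2 - d2)) p"
proof -
  have D: "diff_mat m d \<in> carrier_mat (m - d) m" for m d by (simp add: diff_mat_def)
  have "grid_mat m1 m2 p t s b \<in> carrier_mat (m1 * m2) p" by (simp add: grid_mat_def)
  moreover have "w \<cdot>\<^sub>m 1\<^sub>m (m1 * m2) \<in> carrier_mat (m1 * m2) (m1 * m2)" by simp
  moreover have "(1 / \<delta>1 ^ d1) \<cdot>\<^sub>m kronecker (diff_mat m1 d1) (1\<^sub>m m2) \<in> carrier_mat ((m1 - d1) * m2) (m1 * m2)"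
    by (intro smult_carrier_mat kronecker_carrier D one_carrier_mat)
  moreover have "(1 / \<delta>2 ^ d2) \<cdot>\<^sub>m kronecker (1\<^sub>m m1) (diff_mat m2 d2) \<in> carrier_mat (m1 * (m2 - d2)) (m1 * m2)"
    by (intro smult_carrier_mat kronecker_carrier D one_carrier_mat)
  ultimately show ?thesis
    unfolding penalty_mat_def add.assoc by (intro mult_carrier_mat carrier_append_rows)
qed

theorem theorem2:
  fixes P :: "'w measure"
    and n p m1 m2 d1 d2 L S r1 r2 :: nat
    and x b :: "nat \<Rightarrow> real \<times> real \<Rightarrow> real"
    and \<beta> :: "real \<times> real \<Rightarrow> real"
    and \<epsilon> :: "nat \<Rightarrow> 'w \<Rightarrow> real"
    and y \<eta>_hat \<mu>_hat :: "'w \<Rightarrow> real vec"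
    and \<beta>_hat :: "'w \<Rightarrow> real \<times> real \<Rightarrow> real"
    and \<eta>_star \<mu> :: "real vec"
    and X A V N_inv :: "real mat"
    and N :: "nat \<Rightarrow> real"
    and t s :: "nat \<Rightarrow> real"
    and \<delta>1 \<delta>2 w \<sigma> M C \<E>\<^sub>b lam C\<^sub>b N_max :: real
  \<comment> \<open>the model\<close>
  assumes "prob_space P"
    and "n \<ge> 1" and "p \<ge> 1"
    and "\<And>i. i < n \<Longrightarrow> L2_fun (x i)"
    and "L2_fun \<beta>"
    and "vanishes_on_positive_measure \<beta>"
    and "L2_partials r1 r2 \<beta>"
    and "\<And>\<omega>. \<omega> \<in> space P \<Longrightarrow> y \<omega> = vec n (\<lambda>i. L2_inner (x i) \<beta> + \<epsilon> i \<omega>)"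
  \<comment> \<open>the basis\<close>
    and "\<And>j. j < p \<Longrightarrow> L2_fun (b j)"
    and "L2_independent p b"
    and "is_arg_min (\<lambda>\<eta>. L2_norm (\<lambda>z. \<beta> z - basis_comb b \<eta> z)) (\<lambda>\<eta>. \<eta> \<in> carrier_vec p) \<eta>_star"
    and "\<E>\<^sub>b = L2_norm (\<lambda>z. \<beta> z - basis_comb b \<eta>_star z)"
    and "X = design_mat n p x b"
    and "\<And>j. j < p \<Longrightarrow> N j = emp_norm (col X j)"
    and "\<And>j. j < p \<Longrightarrow> N j > 0"
    and "N_inv = mat_diag p (\<lambda>j. 1 / N j)"
  \<comment> \<open>the matrix A\<close>
    and "d1 < m1" and "d2 < m2"
    and "\<delta>1 > 0" and "\<delta>2 > 0" and "w > 0"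
    and "\<And>k. Suc k < m1 \<Longrightarrow> t (Suc k) - t k = \<delta>1"
    and "\<And>l. Suc l < m2 \<Longrightarrow> s (Suc l) - s l = \<delta>2"
    and "\<And>k l. k < m1 \<Longrightarrow> l < m2 \<Longrightarrow> (t k, s l) \<in> \<Omega>"
    and "L = m1 * m2 + (m1 - d1) * m2 + m1 * (m2 - d2)"
    and "A = penalty_mat m1 m2 d1 d2 \<delta>1 \<delta>2 w p t s b"
    and "vec_space.rank L A = p"
    and "V = X * pseudoinverse A"
  \<comment> \<open>errors, covariates, sparsity, restricted eigenvalue\<close>
    and "\<sigma> > 0"
    and "prob_space.indep_vars P (\<lambda>_. borel) \<epsilon> {..<n}"
    and "\<And>i. i < n \<Longrightarrow> distributed P lborel (\<epsilon> i) (normal_density 0 \<sigma>)"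
    and "\<And>i. i < n \<Longrightarrow> L2_norm (x i) \<le> M"
    and "1 \<le> S" and "S \<le> L"
    and "card {i. i < L \<and> (A *\<^sub>v \<eta>_star) $ i \<noteq> 0} \<le> S"
    and "kappa1 V S > 0"
  \<comment> \<open>the estimator\<close>
    and "C > sqrt 2"
    and "lam = C * \<sigma> * sqrt (ln (real p) / real n) + M * \<E>\<^sub>b"
    and "\<And>\<omega>. \<omega> \<in> space P \<Longrightarrow>
           is_arg_min (\<lambda>\<eta>. vec_l1 (A *\<^sub>v \<eta>))
             (\<lambda>\<eta>. \<eta> \<in> carrier_vec p \<and>
                vec_linf ((1 / real n) \<cdot>\<^sub>v (N_inv *\<^sub>v (transpose_mat X *\<^sub>v (y \<omega> - X *\<^sub>v \<eta>)))) \<le> lam)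
             (\<eta>_hat \<omega>)"
    and "\<And>\<omega>. \<omega> \<in> space P \<Longrightarrow> \<beta>_hat \<omega> = basis_comb b (\<eta>_hat \<omega>)"
    and "\<mu> = vec n (\<lambda>i. L2_inner (x i) \<beta>)"
    and "\<And>\<omega>. \<omega> \<in> space P \<Longrightarrow> \<mu>_hat \<omega> = vec n (\<lambda>i. L2_inner (x i) (\<beta>_hat \<omega>))"
    and "C\<^sub>b = sqrt (\<Sum>j<p. LINT z|lebesgue_on \<Omega>. (b j z)\<^sup>2)"
    and "N_max = Max (N ` {..<p})"
  shows "with_prob_at_least P (1 - real p powr (1 - C\<^sup>2 / 2))
           (\<lambda>\<omega>. L2_norm (\<lambda>z. \<beta>_hat \<omega> z - \<beta> z)
                   \<le> 8 * C\<^sub>b * sqrt (real L) * N_max / ((kappa1 V S)\<^sup>2 * (sigma_min A)\<^sup>2) * lam * real S + \<E>\<^sub>b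
                \<and> emp_norm (\<mu>_hat \<omega> - \<mu>)
                   \<le> 4 * sqrt (real L) * N_max / (kappa1 V S * sigma_min A) * lam * sqrt (real S) + M * \<E>\<^sub>b)
       \<and> (2 * S \<le> L \<and> kappa2 V S S > 0 \<longrightarrow>
          with_prob_at_least P (1 - real p powr (1 - C\<^sup>2 / 2))
            (\<lambda>\<omega>. L2_norm (\<lambda>z. \<beta>_hat \<omega> z - \<beta> z)
                   \<le> 8 * C\<^sub>b * sqrt (real L) * N_max / ((kappa2 V S S)\<^sup>2 * (sigma_min A)\<^sup>2) * lam * sqrt (real S) + \<E>\<^sub>b))"
proof -
  interpret prob_space P by fact
  note n = \<open>n \<ge> 1\<close> and p = \<open>p \<ge> 1\<close> and x = \<open>\<And>i. i < n \<Longrightarrow> L2_fun (x i)\<close> and \<beta> = \<open>L2_fun \<beta>\<close>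
    and b = \<open>\<And>j. j < p \<Longrightarrow> L2_fun (b j)\<close> and X_eq = \<open>X = design_mat n p x b\<close>
    and N_eq = \<open>\<And>j. j < p \<Longrightarrow> N j = emp_norm (col X j)\<close> and N_pos = \<open>\<And>j. j < p \<Longrightarrow> N j > 0\<close>
    and E_eq = \<open>\<E>\<^sub>b = L2_norm (\<lambda>z. \<beta> z - basis_comb b \<eta>_star z)\<close>
    and M = \<open>\<And>i. i < n \<Longrightarrow> L2_norm (x i) \<le> M\<close> and \<sigma> = \<open>\<sigma> > 0\<close>
    and lam_eq = \<open>lam = C * \<sigma> * sqrt (ln (real p) / real n) + M * \<E>\<^sub>b\<close>
    and y_eq = \<open>\<And>\<omega>. \<omega> \<in> space P \<Longrightarrow> y \<omega> = vec n (\<lambda>i. L2_inner (x i) \<beta> + \<epsilon> i \<omega>)\<close>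
  have \<eta>_star: "\<eta>_star \<in> carrier_vec p"
    using assms(11) by (simp add: is_arg_min_def)
  have X: "X \<in> carrier_mat n p" by (simp add: X_eq design_mat_def)
  have A: "A \<in> carrier_mat L p" unfolding assms(25,26) by (rule penalty_mat_carrier)
  have comb: "L2_fun (basis_comb b \<eta>)" if "\<eta> \<in> carrier_vec p" for \<eta>
    using b that by (intro L2_fun_basis_comb) auto
  have X_mult: "X *\<^sub>v \<eta> = vec n (\<lambda>i. L2_inner (x i) (basis_comb b \<eta>))" if "\<eta> \<in> carrier_vec p" for \<eta>
    unfolding X_eq using x b that by (intro design_mat_mult_vec) auto
  have E0: "\<E>\<^sub>b \<ge> 0" by (simp add: E_eq)
  have M0: "M \<ge> 0" using M[of 0] n L2_norm_nonneg[of "x 0"] by linarith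
  have C0: "C \<ge> 0" using \<open>C > sqrt 2\<close> real_sqrt_ge_zero[of 2] by linarith
  have lam0: "lam \<ge> 0" using C0 \<sigma> E0 M0 p by (simp add: lam_eq)

  \<comment> \<open>Bias of the basis approximation\<close>
  define g where "g = vec n (\<lambda>i. L2_inner (x i) (\<lambda>z. \<beta> z - basis_comb b \<eta>_star z))"
  have g: "g \<in> carrier_vec n" by (simp add: g_def)
  have g_le: "emp_norm g \<le> M * \<E>\<^sub>b"
  proof (rule emp_norm_le)
    fix i assume "i < dim_vec g"
    then have i: "i < n" by (simp add: g_def)
    have "\<bar>g $ i\<bar> \<le> L2_norm (x i) * \<E>\<^sub>b"
      unfolding g_def E_eq using i by (simp add: L2_Cauchy_Schwarz x L2_fun_diff \<beta> comb \<eta>_star)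
    also have "\<dots> \<le> M * \<E>\<^sub>b" using M[OF i] E0 by (rule mult_right_mono)
    finally show "\<bar>g $ i\<bar> \<le> M * \<E>\<^sub>b" .
  qed (use n E0 M0 in \<open>auto simp: g_def\<close>)
  have g_eq: "g $ i = L2_inner (x i) \<beta> - (X *\<^sub>v \<eta>_star) $ i" if "i < n" for i
    using that by (simp add: g_def X_mult[OF \<eta>_star] L2_inner_diff_right x \<beta> comb \<eta>_star)

  \<comment> \<open>The event on which the noise is small\<close>
  define a where "a j i = X $$ (i, j) / (real n * N j)" for j i
  \<comment> \<open>Chosen so that \<open>u * \<sigma> * \<tau>\<close> is the noise part of
    \<open>lam\<close>, and so that each tail bound is \<open>p\<close> to the power
    \<open>- (C\<^sup>2 / 2)\<close>.\<close>
  define u where "u = C * sqrt (ln (real p))"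
  define \<tau> where "\<tau> = 1 / sqrt (real n)"
  define G where "G = {\<omega> \<in> space P. \<forall>j\<in>{..<p}. \<bar>\<Sum>i\<in>{..<n}. a j i * \<epsilon> i \<omega>\<bar> \<le> u * \<sigma> * \<tau>}"
  \<comment> \<open>Dividing column \<open>j\<close> by its empirical norm gives all combinations
    the same variance.\<close>
  have a_sum: "(\<Sum>i\<in>{..<n}. (a j i)\<^sup>2) = \<tau>\<^sup>2" if j: "j \<in> {..<p}" for j
  proof -
    have "(N j)\<^sup>2 = (\<Sum>i<n. (X $$ (i, j))\<^sup>2) / real n"
      using j X by (simp add: N_eq emp_norm_def sum_nonneg)
    then have "(\<Sum>i<n. (X $$ (i, j))\<^sup>2) = real n * (N j)\<^sup>2"
      using n by (simp add: field_simps)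
    then have "(\<Sum>i<n. (a j i)\<^sup>2) = real n * (N j)\<^sup>2 / (real n * N j)\<^sup>2"
      by (simp add: a_def power_divide sum_divide_distrib[symmetric])
    also have "\<dots> = \<tau>\<^sup>2"
      using n N_pos[of j] j by (simp add: \<tau>_def power_divide power2_eq_square)
    finally show ?thesis .
  qed
  have \<tau>: "\<tau> > 0" using n by (simp add: \<tau>_def)
  have u: "u \<ge> 0" using C0 p by (simp add: u_def)
  note bound = normal_linear_combinations_bound[where a = a, OF finite_lessThan finite_lessThan[of p] assms(30) _ \<sigma> a_sum \<tau> u,
      folded G_def]
  have G: "G \<in> events" using bound(1) assms(31) by simp
  have G_prob: "1 - real p powr (1 - C\<^sup>2 / 2) \<le> prob G"
  proof -
    have "real p * exp (- (u\<^sup>2 / 2)) = real p powr 1 * real p powr (- (C\<^sup>2 / 2))"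
      using p by (simp add: u_def power_mult_distrib powr_def mult.commute)
    also have "\<dots> = real p powr (1 - C\<^sup>2 / 2)"
      unfolding powr_add[symmetric] by simp
    finally show ?thesis using bound(2) assms(31) by simp
  qed

  \<comment> \<open>Error bounds on this event\<close>
  have main: "L2_norm (\<lambda>z. \<beta>_hat \<omega> z - \<beta> z) \<le> C\<^sub>b * vec_l2 (\<eta>_hat \<omega> - \<eta>_star) + \<E>\<^sub>b"
    "emp_norm (\<mu>_hat \<omega> - \<mu>) \<le> emp_norm (X *\<^sub>v (\<eta>_hat \<omega> - \<eta>_star)) + M * \<E>\<^sub>b"
    "emp_norm (X *\<^sub>v (\<eta>_hat \<omega> - \<eta>_star))
      \<le> 4 * (sqrt (real L) * N_max) / (kappa1 V S * sigma_min A) * lam * sqrt (real S)"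
    "vec_l2 (\<eta>_hat \<omega> - \<eta>_star)
      \<le> 8 * (sqrt (real L) * N_max) / ((kappa1 V S)\<^sup>2 * (sigma_min A)\<^sup>2) * lam * real S"
    "2 * S \<le> L \<Longrightarrow> kappa2 V S S > 0 \<Longrightarrow> vec_l2 (\<eta>_hat \<omega> - \<eta>_star)
      \<le> 8 * (sqrt (real L) * N_max) / ((kappa2 V S S)\<^sup>2 * (sigma_min A)\<^sup>2) * lam"
    if \<omega>: "\<omega> \<in> G" for \<omega>
  proof -
    have \<omega>P: "\<omega> \<in> space P" using \<omega> by (simp add: G_def)
    have y: "y \<omega> \<in> carrier_vec n" by (simp add: y_eq[OF \<omega>P])
    have res: "y \<omega> - X *\<^sub>v \<eta> \<in> carrier_vec n" if "\<eta> \<in> carrier_vec p" for \<eta>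
      using y X that by (intro minus_carrier_vec mult_mat_vec_carrier[of _ n p])
    have constraint: "vec_linf ((1 / real n) \<cdot>\<^sub>v (N_inv *\<^sub>v (transpose_mat X *\<^sub>v (y \<omega> - X *\<^sub>v \<eta>)))) \<le> lam
        \<longleftrightarrow> (\<forall>j<p. \<bar>col X j \<bullet> (y \<omega> - X *\<^sub>v \<eta>)\<bar> \<le> real n * N j * lam)"
      if "\<eta> \<in> carrier_vec p" for \<eta>
      unfolding \<open>N_inv = mat_diag p (\<lambda>j. 1 / N j)\<close>
      by (rule scaled_residual_linf_le_iff[OF X res[OF that] n p N_pos])
    have feas: "\<bar>col X j \<bullet> (y \<omega> - X *\<^sub>v \<eta>_star)\<bar> \<le> real n * N j * lam" if j: "j < p" for j
    proof -
      have c: "col X j \<in> carrier_vec n" using X by auto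
      define e where "e = vec n (\<lambda>i. \<epsilon> i \<omega>)"
      have e: "e \<in> carrier_vec n" by (simp add: e_def)
      \<comment> \<open>The residual of the target is noise plus bias, and the two terms of
        \<open>lam\<close> absorb one each.\<close>
      have "y \<omega> - X *\<^sub>v \<eta>_star = e + g"
        using X g by (intro eq_vecI) (auto simp: y_eq[OF \<omega>P] e_def g_eq)
      then have split: "col X j \<bullet> (y \<omega> - X *\<^sub>v \<eta>_star) = col X j \<bullet> e + col X j \<bullet> g"
        by (simp add: scalar_prod_add_distrib[OF c e g])
      have pos: "real n * N j > 0" using n N_pos[OF j] by simp
      have "(\<Sum>i<n. a j i * \<epsilon> i \<omega>) = (col X j \<bullet> e) / (real n * N j)"
        using X j by (simp add: a_def e_def scalar_prod_def atLeast0LessThan sum_divide_distrib)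
      moreover have "\<bar>\<Sum>i<n. a j i * \<epsilon> i \<omega>\<bar> \<le> u * \<sigma> * \<tau>"
        using \<omega> j by (simp add: G_def)
      moreover have "u * \<sigma> * \<tau> = C * \<sigma> * sqrt (ln (real p) / real n)"
        by (simp add: u_def \<tau>_def real_sqrt_divide)
      ultimately have noise: "\<bar>col X j \<bullet> e\<bar> \<le> (C * \<sigma> * sqrt (ln (real p) / real n)) * (real n * N j)"
        by (simp only: abs_divide abs_of_pos[OF pos] pos_divide_le_eq[OF pos])
      have "\<bar>col X j \<bullet> g\<bar> \<le> real n * N j * emp_norm g"
        using abs_scalar_prod_le_emp_norm[OF c g n] by (simp add: N_eq[OF j])
      also have "\<dots> \<le> real n * N j * (M * \<E>\<^sub>b)"
        using g_le pos by (intro mult_left_mono) auto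
      finally have bias: "\<bar>col X j \<bullet> g\<bar> \<le> real n * N j * (M * \<E>\<^sub>b)" .
      have "\<bar>col X j \<bullet> e + col X j \<bullet> g\<bar> \<le> \<bar>col X j \<bullet> e\<bar> + \<bar>col X j \<bullet> g\<bar>"
        by (rule abs_triangle_ineq)
      also have "\<dots> \<le> (C * \<sigma> * sqrt (ln (real p) / real n)) * (real n * N j) + real n * N j * (M * \<E>\<^sub>b)"
        by (rule add_mono[OF noise bias])
      also have "\<dots> = real n * N j * lam" by (simp add: lam_eq algebra_simps)
      finally show ?thesis unfolding split .
    qed
    note hat = assms(39)[OF \<omega>P, unfolded is_arg_min_def]
    have \<eta>_hat: "\<eta>_hat \<omega> \<in> carrier_vec p" using hat by blast
    have feas_hat: "\<bar>col X j \<bullet> (y \<omega> - X *\<^sub>v \<eta>_hat \<omega>)\<bar> \<le> real n * N j * lam" if "j < p" for j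
      using hat constraint[OF \<eta>_hat] that by blast
    \<comment> \<open>No feasible vector has a strictly smaller penalty than the estimator, and the
      target has just been shown feasible.\<close>
    have le: "vec_l1 (A *\<^sub>v \<eta>_hat \<omega>) \<le> vec_l1 (A *\<^sub>v \<eta>_star)"
      using hat constraint[OF \<eta>_star] feas \<eta>_star by (meson not_less)
    note err = X A \<open>vec_space.rank L A = p\<close> n p N_pos y \<eta>_star \<eta>_hat feas feas_hat le assms(35) lam0
    show "emp_norm (X *\<^sub>v (\<eta>_hat \<omega> - \<eta>_star))
        \<le> 4 * (sqrt (real L) * N_max) / (kappa1 V S * sigma_min A) * lam * sqrt (real S)"
      using prediction_error_kappa1[OF err] \<open>kappa1 V S > 0\<close> unfolding assms(28,44) by blast
    show "vec_l2 (\<eta>_hat \<omega> - \<eta>_star)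
        \<le> 8 * (sqrt (real L) * N_max) / ((kappa1 V S)\<^sup>2 * (sigma_min A)\<^sup>2) * lam * real S"
      using coefficient_error_kappa1[OF err] \<open>kappa1 V S > 0\<close> unfolding assms(28,44) by blast
    show "vec_l2 (\<eta>_hat \<omega> - \<eta>_star)
        \<le> 8 * (sqrt (real L) * N_max) / ((kappa2 V S S)\<^sup>2 * (sigma_min A)\<^sup>2) * lam"
      if "2 * S \<le> L" "kappa2 V S S > 0"
      using coefficient_error_kappa2[OF err] that \<open>1 \<le> S\<close> unfolding assms(28,44) by blast
    define d where "d = \<eta>_hat \<omega> - \<eta>_star"
    have d: "d \<in> carrier_vec p" using \<eta>_hat \<eta>_star by (simp add: d_def)
    have "\<beta>_hat \<omega> z - \<beta> z = basis_comb b d z + (basis_comb b \<eta>_star z - \<beta> z)" for z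
      using \<eta>_hat \<eta>_star
      by (simp add: assms(40)[OF \<omega>P] basis_comb_def d_def right_diff_distrib sum_subtractf)
    then have "L2_norm (\<lambda>z. \<beta>_hat \<omega> z - \<beta> z)
        = L2_norm (\<lambda>z. basis_comb b d z + (basis_comb b \<eta>_star z - \<beta> z))" by (simp only:)
    also have "\<dots> \<le> L2_norm (basis_comb b d) + L2_norm (\<lambda>z. basis_comb b \<eta>_star z - \<beta> z)"
      by (intro L2_norm_triangle L2_fun_diff comb d \<eta>_star \<beta>)
    also have "\<dots> \<le> C\<^sub>b * vec_l2 d + \<E>\<^sub>b"
      using L2_norm_basis_comb_le[of d b] b d
      by (simp add: assms(43) E_eq L2_norm_minus_commute[of \<beta>])
    finally show "L2_norm (\<lambda>z. \<beta>_hat \<omega> z - \<beta> z) \<le> C\<^sub>b * vec_l2 (\<eta>_hat \<omega> - \<eta>_star) + \<E>\<^sub>b"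
      by (simp add: d_def)
    have g': "- g \<in> carrier_vec n" using g by simp
    have Xd: "X *\<^sub>v d \<in> carrier_vec n" using X d by (rule mult_mat_vec_carrier)
    have "\<mu>_hat \<omega> = X *\<^sub>v \<eta>_hat \<omega>"
      unfolding X_mult[OF \<eta>_hat] assms(42)[OF \<omega>P] assms(40)[OF \<omega>P] ..
    moreover have "X *\<^sub>v d = X *\<^sub>v \<eta>_hat \<omega> - X *\<^sub>v \<eta>_star"
      unfolding d_def by (rule mult_minus_distrib_mat_vec[OF X \<eta>_hat \<eta>_star])
    \<comment> \<open>Estimation error minus bias; \<open>g\<close> is the part of the mean that the
      basis misses.\<close>
    ultimately have "\<mu>_hat \<omega> - \<mu> = X *\<^sub>v d + (- g)"
      using X g by (intro eq_vecI) (auto simp: assms(41) g_eq simp del: index_mult_mat_vec)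
    then have "emp_norm (\<mu>_hat \<omega> - \<mu>) \<le> emp_norm (X *\<^sub>v d) + emp_norm (- g)"
      using emp_norm_triangle[OF Xd g'] by simp
    also have "emp_norm (- g) = emp_norm g" by (simp add: emp_norm_def)
    finally show "emp_norm (\<mu>_hat \<omega> - \<mu>) \<le> emp_norm (X *\<^sub>v (\<eta>_hat \<omega> - \<eta>_star)) + M * \<E>\<^sub>b"
      using g_le by (simp add: d_def)
  qed

  \<comment> \<open>From bounds on the event to the probability statements\<close>
  have C\<^sub>b: "C\<^sub>b \<ge> 0" unfolding assms(43) by (intro real_sqrt_ge_zero sum_nonneg) simp
  show ?thesis
    unfolding with_prob_at_least_def
  \<comment> \<open>The same event \<open>G\<close> witnesses both statements, hence the same
    probability.\<close>
  proof (intro conjI impI bexI[OF _ G] G_prob ballI)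
    fix \<omega> assume \<omega>: "\<omega> \<in> G"
    show "L2_norm (\<lambda>z. \<beta>_hat \<omega> z - \<beta> z)
        \<le> 8 * C\<^sub>b * sqrt (real L) * N_max / ((kappa1 V S)\<^sup>2 * (sigma_min A)\<^sup>2) * lam * real S + \<E>\<^sub>b"
      using main(1)[OF \<omega>] mult_left_mono[OF main(4)[OF \<omega>] C\<^sub>b] by (simp add: mult_ac)
    show "emp_norm (\<mu>_hat \<omega> - \<mu>)
        \<le> 4 * sqrt (real L) * N_max / (kappa1 V S * sigma_min A) * lam * sqrt (real S) + M * \<E>\<^sub>b"
      using main(2,3)[OF \<omega>] by (simp add: mult_ac)
  next
    fix \<omega> assume \<omega>: "\<omega> \<in> G" and \<kappa>: "2 * S \<le> L \<and> kappa2 V S S > 0"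
    let ?Q = "8 * (sqrt (real L) * N_max) / ((kappa2 V S S)\<^sup>2 * (sigma_min A)\<^sup>2) * lam"
    have Q: "vec_l2 (\<eta>_hat \<omega> - \<eta>_star) \<le> ?Q" using main(5)[OF \<omega>] \<kappa> by blast
    \<comment> \<open>Nonnegative because it bounds a norm; as \<open>1 \<le> S\<close>, multiplying
      by \<open>sqrt (real S)\<close> weakens the bound to the stated form.\<close>
    then have "?Q \<ge> 0" using vec_l2_nonneg by (rule order_trans[rotated])
    then have "?Q * 1 \<le> ?Q * sqrt (real S)" using \<open>1 \<le> S\<close> by (intro mult_left_mono) auto
    with Q have "vec_l2 (\<eta>_hat \<omega> - \<eta>_star) \<le> ?Q * sqrt (real S)" by linarith
    from mult_left_mono[OF this C\<^sub>b] main(1)[OF \<omega>]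
    show "L2_norm (\<lambda>z. \<beta>_hat \<omega> z - \<beta> z)
        \<le> 8 * C\<^sub>b * sqrt (real L) * N_max / ((kappa2 V S S)\<^sup>2 * (sigma_min A)\<^sup>2) * lam * sqrt (real S) + \<E>\<^sub>b"
      by (simp add: mult_ac)
  qed
qed

end
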